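(* Let $a,b\in\mathbb{M}_n$ with $0\le a,b\le 1$ be strict elements such that $a$ is absolutely compatible with $b$. Then $n$ is even, say $n=2k$, and there exist $a_1,\dots,a_k,b_1,\dots,b_k\in\mathcal{S}$ and a unitary $w\in\mathbb{M}_n$ such that $a_i$ is absolutely compatible with $b_i$ for every $i=1,\dots,k$, and $$a=w^*(a_1\oplus\cdots\oplus a_k)w,\qquad b=w^*(b_1\oplus\cdots\oplus b_k)w.$$
   Context: $\mathbb{M}_n$ is the algebra of $n\times n$ complex matrices. For $x$ in it, $|x|=(x^*x)^{1/2}$. Elements $0\le a,b\le 1$ are absolutely compatible if $|a-b|+|1-a-b|=1$. For positive $x$, $r(x)$ is its range projection; for $0\le a\le 1$, $s(a)=1-r(1-a)$ and $n(a)=1-r(a)$; a non-zero $0\le a\le1$ is strict if $s(a)=0=n(a)$. $\mathcal{S}=\{c\in\mathbb{M}_2: 0\le c\le 1,\ \operatorname{trace}(c)=1,\ 0<\det(c)<\tfrac14\}$, with $\operatorname{trace}$ the non-normalized trace. *)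

theory Defs
  imports Complex_Main "Jordan_Normal_Form.Schur_Decomposition" "Jordan_Normal_Form.Determinant"
begin

definition mat_trace :: "complex mat \<Rightarrow> complex" where
  "mat_trace A = (\<Sum>i<dim_row A. A $$ (i, i))"

definition hermitian :: "complex mat \<Rightarrow> bool" where
  "hermitian A \<longleftrightarrow> A \<in> carrier_mat (dim_row A) (dim_row A) \<and> mat_adjoint A = A"

definition positive_mat :: "complex mat \<Rightarrow> bool" where
  "positive_mat A \<longleftrightarrow> hermitian A \<and>
     (\<forall>v \<in> carrier_vec (dim_row A). 0 \<le> (A *\<^sub>v v) \<bullet>c v)"

definition effect :: "complex mat \<Rightarrow> bool" where
  "effect a \<longleftrightarrow> positive_mat a \<and> positive_mat (1\<^sub>m (dim_row a) - a)"

definition mat_sqrt :: "complex mat \<Rightarrow> complex mat" where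
  "mat_sqrt x = (THE y. positive_mat y \<and> dim_row y = dim_row x \<and> y * y = x)"

definition mat_abs :: "complex mat \<Rightarrow> complex mat" where
  "mat_abs x = mat_sqrt (mat_adjoint x * x)"

definition abs_compatible :: "complex mat \<Rightarrow> complex mat \<Rightarrow> bool" where
  "abs_compatible a b \<longleftrightarrow>
     mat_abs (a - b) + mat_abs (1\<^sub>m (dim_row a) - a - b) = 1\<^sub>m (dim_row a)"

definition mat_range :: "complex mat \<Rightarrow> complex vec set" where
  "mat_range x = {x *\<^sub>v v | v. v \<in> carrier_vec (dim_col x)}"

definition range_proj :: "complex mat \<Rightarrow> complex mat" where
  "range_proj x = (THE p. p \<in> carrier_mat (dim_row x) (dim_row x) \<and> p * p = p \<and>
       mat_adjoint p = p \<and> mat_range p = mat_range x)"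

definition s_proj :: "complex mat \<Rightarrow> complex mat" where
  "s_proj a = 1\<^sub>m (dim_row a) - range_proj (1\<^sub>m (dim_row a) - a)"

definition n_proj :: "complex mat \<Rightarrow> complex mat" where
  "n_proj a = 1\<^sub>m (dim_row a) - range_proj a"

definition strict :: "complex mat \<Rightarrow> bool" where
  "strict a \<longleftrightarrow> effect a \<and> a \<noteq> 0\<^sub>m (dim_row a) (dim_row a) \<and>
     s_proj a = 0\<^sub>m (dim_row a) (dim_row a) \<and> n_proj a = 0\<^sub>m (dim_row a) (dim_row a)"

definition unitary_mat :: "complex mat \<Rightarrow> bool" where
  "unitary_mat w \<longleftrightarrow> w \<in> carrier_mat (dim_row w) (dim_row w) \<and>
     mat_adjoint w * w = 1\<^sub>m (dim_row w) \<and> w * mat_adjoint w = 1\<^sub>m (dim_row w)"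

(* the set \<S> (ordering on complex is that of HOL-Library.Complex_Order) *)
definition S_set :: "complex mat set" where
  "S_set = {c. c \<in> carrier_mat 2 2 \<and> effect c \<and> mat_trace c = 1 \<and>
               0 < det c \<and> det c < 1/4}"

end

(*
  Put x = a - b and y = 1 - a - b. Absolute compatibility says |x| = P and |y| = 1 - P, so P commutes
  with x and y, and x commutes with K = xy + yx because x^2 = P^2. A common eigenvector e of x and K
  therefore spans together with ye a subspace invariant under x, y and P, on which P is a scalar;
  strictness rules out that it is a line. Splitting off this plane and its orthogonal complement,
  one concludes by induction. On the plane x and y have scalar squares but, again by strictness,
  are not scalar; hence they are traceless, which gives trace 1 for a and b.
*)

theory Submission
  imports Defs "Jordan_Normal_Form.Spectral_Radius"
begin

section \<open>Adjoints and orthonormal lists\<close>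

text \<open>The obstacle is that \<open>x\<close> and \<open>y\<close> need not commute, so there is
  no common eigenbasis. A Clifford-type relation takes its place: x^2, y^2 and the anticommutator
  \<open>K\<close> all commute with both \<open>x\<close> and \<open>y\<close>, since x^2 = P^2 and
  y^2 = (1 - P)^2. Every product of \<open>x\<close> and \<open>y\<close> is therefore a combination
  of 1, x, y, xy with coefficients in the commutative algebra generated by \<open>P\<close> and
  \<open>K\<close>; this is why planes suffice. Taking e to be an eigenvector of \<open>x\<close> as
  well makes the plane explicit: if xe = te and Ke = ke, then x(ye) = ke - t(ye) and y(ye) = (1 -
  |t|)^2 e.

  A second obstacle is that the absolute value and the range projection are definite descriptions.
  Uniqueness theorems trade them for equations between squares and for nonzero determinants, which
  survive unitary conjugation and restriction to diagonal blocks.\<close>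

lemma mat_adjoint_dim[simp]:
  "dim_row (mat_adjoint A) = dim_col A" "dim_col (mat_adjoint A) = dim_row A"
  unfolding mat_adjoint_def by auto

lemma mat_adjoint_carrier[simp]: "A \<in> carrier_mat m n \<Longrightarrow> mat_adjoint A \<in> carrier_mat n m"
  by (metis carrier_matD carrier_matI mat_adjoint_dim)

lemma mat_adjoint_index[simp]:
  fixes A :: "complex mat"
  assumes "i < dim_col A" "j < dim_row A"
  shows "mat_adjoint A $$ (i,j) = cnj (A $$ (j,i))"
  using assms unfolding mat_adjoint_def by (auto simp: mat_of_rows_def)

lemma mat_adjoint_adjoint[simp]: "mat_adjoint (mat_adjoint (A :: complex mat)) = A"
  by (rule eq_matI) auto

lemma mat_adjoint_one[simp]: "mat_adjoint (1\<^sub>m n :: complex mat) = 1\<^sub>m n"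
  by (rule eq_matI) auto

lemma mat_adjoint_add:
  fixes A B :: "complex mat"
  assumes "A \<in> carrier_mat m n" "B \<in> carrier_mat m n"
  shows "mat_adjoint (A + B) = mat_adjoint A + mat_adjoint B"
  using assms by (intro eq_matI) auto

lemma mat_adjoint_minus:
  fixes A B :: "complex mat"
  assumes "A \<in> carrier_mat m n" "B \<in> carrier_mat m n"
  shows "mat_adjoint (A - B) = mat_adjoint A - mat_adjoint B"
  using assms by (intro eq_matI) auto

lemma mat_adjoint_mult:
  fixes A B :: "complex mat"
  assumes "A \<in> carrier_mat m n" "B \<in> carrier_mat n k"
  shows "mat_adjoint (A * B) = mat_adjoint B * mat_adjoint A"
  using assms by (intro eq_matI) (auto simp: scalar_prod_def mult.commute)

lemma mat_adjoint_four_block: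
  fixes A :: "complex mat"
  assumes "A \<in> carrier_mat n n" "D \<in> carrier_mat m m"
  shows "mat_adjoint (four_block_mat A (0\<^sub>m n m) (0\<^sub>m m n) D)
    = four_block_mat (mat_adjoint A) (0\<^sub>m n m) (0\<^sub>m m n) (mat_adjoint D)"
  using assms by (intro eq_matI) auto

lemma mat_adjoint_mat_diag: "mat_adjoint (mat_diag n f :: complex mat) = mat_diag n (\<lambda>i. cnj (f i))"
  by (intro eq_matI) (auto simp: mat_diag_def)

lemma cscalar_prod_sum:
  fixes v w :: "complex vec"
  assumes "w \<in> carrier_vec n"
  shows "v \<bullet>c w = (\<Sum>i<n. v $ i * cnj (w $ i))"
  using assms by (auto simp: scalar_prod_def atLeast0LessThan intro!: sum.cong)

lemma cscalar_prod_cnj: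
  fixes v w :: "complex vec"
  assumes "v \<in> carrier_vec n" "w \<in> carrier_vec n"
  shows "w \<bullet>c v = cnj (v \<bullet>c w)"
  using assms by (simp add: cscalar_prod_sum[of _ n] mult.commute)

lemma cscalar_prod_add:
  fixes u v w :: "complex vec"
  assumes "u \<in> carrier_vec n" "v \<in> carrier_vec n" "w \<in> carrier_vec n"
  shows "(u + v) \<bullet>c w = u \<bullet>c w + v \<bullet>c w" "w \<bullet>c (u + v) = w \<bullet>c u + w \<bullet>c v"
    "(u - v) \<bullet>c w = u \<bullet>c w - v \<bullet>c w" "w \<bullet>c (u - v) = w \<bullet>c u - w \<bullet>c v"
    "(c \<cdot>\<^sub>v u) \<bullet>c w = c * (u \<bullet>c w)" "w \<bullet>c (c \<cdot>\<^sub>v u) = cnj c * (w \<bullet>c u)"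
  using assms
  by (auto simp: cscalar_prod_sum[of _ n] sum.distrib sum_subtractf sum_distrib_left algebra_simps)

lemma cscalar_prod_self:
  fixes v :: "complex vec"
  shows "v \<bullet>c v = complex_of_real (\<Sum>i<dim_vec v. (cmod (v $ i))\<^sup>2)"
  by (simp only: cscalar_prod_sum[OF carrier_vec_dim_vec] of_real_sum complex_norm_square)

lemma cscalar_prod_self_eq_0:
  fixes v :: "complex vec"
  assumes "v \<in> carrier_vec n"
  shows "v \<bullet>c v = 0 \<longleftrightarrow> v = 0\<^sub>v n"
  using assms by simp

lemma mat_adjoint_cscalar:
  fixes A :: "complex mat"
  assumes "A \<in> carrier_mat m n" "v \<in> carrier_vec n" "w \<in> carrier_vec m"
  shows "(A *\<^sub>v v) \<bullet>c w = v \<bullet>c (mat_adjoint A *\<^sub>v w)"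
proof -
  have "(A *\<^sub>v v) \<bullet>c w = (\<Sum>i<m. \<Sum>j<n. A $$ (i,j) * v $ j * cnj (w $ i))"
    using assms by (auto simp: cscalar_prod_sum[of _ m] scalar_prod_def sum_distrib_right
        atLeast0LessThan intro!: sum.cong)
  also have "\<dots> = (\<Sum>j<n. \<Sum>i<m. A $$ (i,j) * v $ j * cnj (w $ i))"
    by (rule sum.swap)
  also have "\<dots> = v \<bullet>c (mat_adjoint A *\<^sub>v w)"
    using assms mult_mat_vec_carrier[OF mat_adjoint_carrier[OF assms(1)] assms(3)] by (subst cscalar_prod_sum[of _ n]) (auto simp: scalar_prod_def sum_distrib_left
        atLeast0LessThan mult_ac intro!: sum.cong)
  finally show ?thesis .
qed

lemma hermitian_iff:
  assumes "A \<in> carrier_mat n n"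
  shows "hermitian A \<longleftrightarrow> mat_adjoint A = A"
  using assms unfolding hermitian_def by auto

lemma hermitian_cscalar:
  assumes "hermitian A" "A \<in> carrier_mat n n" "v \<in> carrier_vec n" "w \<in> carrier_vec n"
  shows "(A *\<^sub>v v) \<bullet>c w = v \<bullet>c (A *\<^sub>v w)"
  using assms mat_adjoint_cscalar[of A n n v w] by (simp add: hermitian_def)

lemma hermitian_minus:
  assumes "A \<in> carrier_mat n n" "B \<in> carrier_mat n n" "hermitian A" "hermitian B"
  shows "hermitian (A - B)"
  using assms mat_adjoint_minus[of A n n B] by (auto simp: hermitian_def)

lemma hermitian_one: "hermitian (1\<^sub>m n)"
  by (simp add: hermitian_def)

lemma hermitian_real_eigenvalue:
  assumes "hermitian A" "A \<in> carrier_mat n n" "v \<in> carrier_vec n" "v \<noteq> 0\<^sub>v n" "A *\<^sub>v v = c \<cdot>\<^sub>v v"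
  shows "cnj c = c"
proof -
  have "c * (v \<bullet>c v) = cnj c * (v \<bullet>c v)"
    using hermitian_cscalar[OF assms(1-3) assms(3)] assms
    by (simp add: cscalar_prod_add[of _ n _])
  then show ?thesis using cscalar_prod_self_eq_0[OF assms(3)] assms(4) by simp
qed

lemma vec_normalize:
  fixes v :: "complex vec"
  assumes "v \<in> carrier_vec n" "v \<noteq> 0\<^sub>v n"
  obtains c where "c \<noteq> 0" "(c \<cdot>\<^sub>v v) \<bullet>c (c \<cdot>\<^sub>v v) = 1"
proof -
  define r where "r = (\<Sum>i<dim_vec v. (cmod (v $ i))\<^sup>2)"
  have v: "v \<bullet>c v = complex_of_real r" unfolding r_def by (rule cscalar_prod_self)
  have "r \<ge> 0" unfolding r_def by (intro sum_nonneg) auto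
  moreover have "r \<noteq> 0" using v assms cscalar_prod_self_eq_0[of v n] by auto
  ultimately have r: "r > 0" by simp
  define c where "c = complex_of_real (1 / sqrt r)"
  have "(c \<cdot>\<^sub>v v) \<bullet>c (c \<cdot>\<^sub>v v) = c * (cnj c * (v \<bullet>c v))"
    using assms by (simp add: cscalar_prod_add[of _ n] del: smult_scalar_prod_distrib)
  also have "\<dots> = complex_of_real (1 / sqrt r * (1 / sqrt r * r))"
    unfolding v c_def by (simp only: of_real_mult[symmetric] complex_cnj_complex_of_real)
  also have "1 / sqrt r * (1 / sqrt r * r) = 1" using r by (simp add: field_simps)
  finally have "(c \<cdot>\<^sub>v v) \<bullet>c (c \<cdot>\<^sub>v v) = 1" by simp
  moreover have "c \<noteq> 0" using r c_def by simp
  ultimately show ?thesis using that by blast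
qed

definition orthonormal_list :: "nat \<Rightarrow> complex vec list \<Rightarrow> bool" where
  "orthonormal_list n us \<longleftrightarrow> set us \<subseteq> carrier_vec n \<and>
     (\<forall>i<length us. \<forall>j<length us. us ! i \<bullet>c us ! j = (if i = j then 1 else 0))"

text \<open>The new vector is a kernel vector of a singular matrix instead of the outcome of
  Gram-Schmidt: the conjugated list forms the first rows of \<open>M\<close> and the remaining rows
  are zero, so the kernel of \<open>M\<close> is the orthogonal complement of the list.\<close>

lemma orthonormal_list_snoc:
  assumes "orthonormal_list n us" "length us < n"
  obtains v where "orthonormal_list n (us @ [v])"
proof -
  define M where "M = mat n n (\<lambda>(i,j). if i < length us then cnj (us ! i $ j) else 0)"
  have M: "M \<in> carrier_mat n n" by (simp add: M_def)
  have us: "us ! i \<in> carrier_vec n" if "i < length us" for i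
    using assms that by (auto simp: orthonormal_list_def)
  \<comment> \<open>The list is shorter than \<open>n\<close>, so row \<open>n - 1\<close> is one of
    the zero rows.\<close>
  have "det M = 0"
    using assms laplace_expansion_row[OF M, of "n - 1"] by (simp add: M_def)
  then obtain v where v: "v \<in> carrier_vec n" "v \<noteq> 0\<^sub>v n" "M *\<^sub>v v = 0\<^sub>v n"
    using det_0_iff_vec_prod_zero[OF M] by auto
  have vu: "v \<bullet>c us ! i = 0" if "i < length us" for i
  proof -
    have "0 = (M *\<^sub>v v) $ i" using v assms that by simp
    also have "\<dots> = v \<bullet>c us ! i"
      using assms(2) that us[OF that] v(1)
      by (subst cscalar_prod_sum[of _ n]) (auto simp: M_def scalar_prod_def atLeast0LessThan mult.commute intro!: sum.cong)
    finally show ?thesis by simp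
  qed
  obtain c where c: "c \<noteq> 0" "(c \<cdot>\<^sub>v v) \<bullet>c (c \<cdot>\<^sub>v v) = 1"
    using vec_normalize[OF v(1,2)] by blast
  have 1: "(c \<cdot>\<^sub>v v) \<bullet>c us ! i = 0" if "i < length us" for i
    using vu[OF that] us[OF that] v by (simp add: cscalar_prod_add[of _ n])
  have 2: "us ! i \<bullet>c (c \<cdot>\<^sub>v v) = 0" if "i < length us" for i
    using 1[OF that] us[OF that] v cscalar_prod_cnj[of "c \<cdot>\<^sub>v v" n "us ! i"] by simp
  have "orthonormal_list n (us @ [c \<cdot>\<^sub>v v])"
    using assms v c(2) 1 2 unfolding orthonormal_list_def
    by (auto simp: nth_append less_Suc_eq)
  then show ?thesis using that by blast
qed

lemma orthonormal_list_extend: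
  assumes "orthonormal_list n us" "length us \<le> n"
  obtains vs where "orthonormal_list n (us @ vs)" "length us + length vs = n"
proof -
  have "length us + k \<le> n \<Longrightarrow> \<exists>vs. orthonormal_list n (us @ vs) \<and> length vs = k" for k
  proof (induction k)
    case 0
    then show ?case using assms by auto
  next
    case (Suc k)
    then obtain vs where vs: "orthonormal_list n (us @ vs)" "length vs = k" by auto
    have "length (us @ vs) < n" using vs Suc.prems by simp
    then obtain v where "orthonormal_list n ((us @ vs) @ [v])"
      using orthonormal_list_snoc[OF vs(1)] by blast
    with vs show ?case by (intro exI[of _ "vs @ [v]"]) auto
  qed
  from this[of "n - length us"] assms that show ?thesis by auto
qed

section \<open>Unitary conjugation and block diagonal matrices\<close>

text \<open>The \<open>w\<close> of the theorem is the adjoint of the \<open>W\<close> used here: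
  the columns of \<open>W\<close> are the new basis, and conjugation leads from block form back to
  the given matrix.\<close>

definition uconj :: "complex mat \<Rightarrow> complex mat \<Rightarrow> complex mat" where
  "uconj W X = W * X * mat_adjoint W"

lemma square_mult_closed:
  "A \<in> carrier_mat n n \<Longrightarrow> B \<in> carrier_mat n n \<Longrightarrow> A * B \<in> carrier_mat n n"
  by simp

lemma square_mult_assoc:
  "A \<in> carrier_mat n n \<Longrightarrow> B \<in> carrier_mat n n \<Longrightarrow> C \<in> carrier_mat n n \<Longrightarrow>
    A * B * C = A * (B * C)"
  by (rule assoc_mult_mat)

lemma unitary_matD:
  assumes "unitary_mat W" "W \<in> carrier_mat n n"
  shows "mat_adjoint W * W = 1\<^sub>m n" "W * mat_adjoint W = 1\<^sub>m n"
  using assms unfolding unitary_mat_def by auto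

lemma unitary_matI:
  assumes "W \<in> carrier_mat n n" "mat_adjoint W * W = 1\<^sub>m n"
  shows "unitary_mat W"
  using assms mat_mult_left_right_inverse[of "mat_adjoint W" n W]
  unfolding unitary_mat_def by auto

lemma unitary_mat_adjoint:
  assumes "unitary_mat W"
  shows "unitary_mat (mat_adjoint W)"
proof -
  obtain n where n: "W \<in> carrier_mat n n" using assms unfolding unitary_mat_def by blast
  then show ?thesis using unitary_matD[OF assms n] by (intro unitary_matI[of _ n]) auto
qed

lemma unitary_mat_mult:
  assumes "unitary_mat V" "unitary_mat W" "V \<in> carrier_mat n n" "W \<in> carrier_mat n n"
  shows "unitary_mat (V * W)"
proof (rule unitary_matI)
  have c: "mat_adjoint V \<in> carrier_mat n n" "mat_adjoint W \<in> carrier_mat n n"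
    using assms by auto
  have "mat_adjoint (V * W) * (V * W) = mat_adjoint W * (mat_adjoint V * V) * W"
    using assms c by (simp add: mat_adjoint_mult[of V n n W n] square_mult_assoc[of _ n] square_mult_closed[of _ n])
  then show "mat_adjoint (V * W) * (V * W) = 1\<^sub>m n"
    using assms c unitary_matD by simp
qed (use assms in auto)

lemma uconj_carrier[simp]:
  "W \<in> carrier_mat n n \<Longrightarrow> X \<in> carrier_mat n n \<Longrightarrow> uconj W X \<in> carrier_mat n n"
  unfolding uconj_def by auto

lemma uconj_mult:
  assumes "unitary_mat W" "W \<in> carrier_mat n n" "X \<in> carrier_mat n n" "Y \<in> carrier_mat n n"
  shows "uconj W X * uconj W Y = uconj W (X * Y)"
proof -
  have c: "mat_adjoint W \<in> carrier_mat n n" using assms by auto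
  have "uconj W X * uconj W Y = W * X * (mat_adjoint W * W) * (Y * mat_adjoint W)"
    unfolding uconj_def using assms c by (simp add: square_mult_assoc[of _ n] square_mult_closed[of _ n])
  also have "\<dots> = uconj W (X * Y)"
    unfolding unitary_matD[OF assms(1,2)] uconj_def
    using assms c by (simp add: square_mult_assoc[of _ n] square_mult_closed[of _ n])
  finally show ?thesis .
qed

lemma uconj_minus:
  assumes "W \<in> carrier_mat n n" "X \<in> carrier_mat n n" "Y \<in> carrier_mat n n"
  shows "uconj W X - uconj W Y = uconj W (X - Y)"
  using assms unfolding uconj_def
  by (simp add: mult_minus_distrib_mat[of _ n n _ n] minus_mult_distrib_mat[of _ n n _ _ n]
      square_mult_closed[of _ n])

lemma uconj_one:
  assumes "unitary_mat W" "W \<in> carrier_mat n n"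
  shows "uconj W (1\<^sub>m n) = 1\<^sub>m n"
  using assms unitary_matD unfolding uconj_def by simp

lemma uconj_adjoint:
  assumes "W \<in> carrier_mat n n" "X \<in> carrier_mat n n"
  shows "mat_adjoint (uconj W X) = uconj W (mat_adjoint X)"
proof -
  have "mat_adjoint W \<in> carrier_mat n n" using assms by simp
  then show ?thesis
    using assms unfolding uconj_def
    by (simp add: mat_adjoint_mult[of _ n n _ n] square_mult_assoc[of _ n] square_mult_closed[of _ n])
qed

lemma uconj_uconj:
  assumes "V \<in> carrier_mat n n" "W \<in> carrier_mat n n" "X \<in> carrier_mat n n"
  shows "uconj V (uconj W X) = uconj (V * W) X"
proof -
  have "mat_adjoint V \<in> carrier_mat n n" "mat_adjoint W \<in> carrier_mat n n" using assms by simp_all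
  then show ?thesis
    using assms unfolding uconj_def
    by (simp add: mat_adjoint_mult[of _ n n _ n] square_mult_assoc[of _ n] square_mult_closed[of _ n])
qed

lemma uconj_cancel:
  assumes "unitary_mat W" "W \<in> carrier_mat n n" "X \<in> carrier_mat n n"
  shows "uconj (mat_adjoint W) (uconj W X) = X" "uconj W (uconj (mat_adjoint W) X) = X"
proof -
  have c: "mat_adjoint W \<in> carrier_mat n n" using assms by simp
  show "uconj (mat_adjoint W) (uconj W X) = X" "uconj W (uconj (mat_adjoint W) X) = X"
    using assms c uconj_uconj[OF c assms(2,3)] uconj_uconj[OF assms(2) c assms(3)]
      unitary_matD[OF assms(1,2)] by (simp_all add: uconj_def)
qed

lemma uconj_inj:
  assumes "unitary_mat W" "W \<in> carrier_mat n n" "X \<in> carrier_mat n n" "Y \<in> carrier_mat n n"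
  shows "uconj W X = uconj W Y \<longleftrightarrow> X = Y"
  using uconj_cancel[OF assms(1,2,3)] uconj_cancel[OF assms(1,2,4)] by metis

lemma positive_uconj:
  assumes "W \<in> carrier_mat n n" "X \<in> carrier_mat n n" "positive_mat X"
  shows "positive_mat (uconj W X)"
proof -
  have c: "mat_adjoint W \<in> carrier_mat n n" using assms by simp
  have "hermitian (uconj W X)"
    using assms uconj_adjoint[of W n X] by (auto simp: positive_mat_def hermitian_iff[of _ n])
  moreover have "0 \<le> (uconj W X *\<^sub>v v) \<bullet>c v" if v: "v \<in> carrier_vec n" for v
  proof -
    have cv: "mat_adjoint W *\<^sub>v v \<in> carrier_vec n" using c v by simp
    have "(uconj W X *\<^sub>v v) \<bullet>c v = (W *\<^sub>v (X *\<^sub>v (mat_adjoint W *\<^sub>v v))) \<bullet>c v"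
      using assms c v cv unfolding uconj_def by (simp add: assoc_mult_mat_vec[of _ n n _ n])
    also have "\<dots> = (X *\<^sub>v (mat_adjoint W *\<^sub>v v)) \<bullet>c (mat_adjoint W *\<^sub>v v)"
      using assms c v cv by (intro mat_adjoint_cscalar[of _ n n]) auto
    finally show ?thesis using assms cv unfolding positive_mat_def by auto
  qed
  ultimately show ?thesis using assms unfolding positive_mat_def by (auto simp: uconj_def)
qed

lemma positive_uconj_iff:
  assumes "unitary_mat W" "W \<in> carrier_mat n n" "X \<in> carrier_mat n n"
  shows "positive_mat (uconj W X) \<longleftrightarrow> positive_mat X"
  using positive_uconj[OF assms(2,3)] uconj_cancel[OF assms]
    positive_uconj[of "mat_adjoint W" n "uconj W X"] assms by auto

lemma hermitian_uconj_iff: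
  assumes "unitary_mat W" "W \<in> carrier_mat n n" "X \<in> carrier_mat n n"
  shows "hermitian (uconj W X) \<longleftrightarrow> hermitian X"
  using assms uconj_adjoint[of W n X] uconj_inj[of W n "mat_adjoint X" X]
  by (simp add: hermitian_iff[of _ n])

lemma det_uconj:
  assumes "unitary_mat W" "W \<in> carrier_mat n n" "X \<in> carrier_mat n n"
  shows "det (uconj W X) = det X"
proof -
  have c: "mat_adjoint W \<in> carrier_mat n n" using assms by simp
  have 1: "det W * det (mat_adjoint W) = 1"
    using det_mult[OF assms(2) c] unitary_matD[OF assms(1,2)] by simp
  have "det (uconj W X) = det W * det X * det (mat_adjoint W)"
    using assms c det_mult[of "W * X" n "mat_adjoint W"] det_mult[of W n X] by (simp add: uconj_def)
  also have "\<dots> = det X * (det W * det (mat_adjoint W))" by simp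
  finally show ?thesis using 1 by simp
qed

section \<open>Diagonal sums of two blocks\<close>

text \<open>The shape follows the recursion of \<open>diag_block_mat\<close>, so that a list of
  blocks can be built up by putting one block in front. The two sizes fix the shapes of the zero
  blocks.\<close>

abbreviation bdiag :: "nat \<Rightarrow> nat \<Rightarrow> complex mat \<Rightarrow> complex mat \<Rightarrow> complex mat" where
  "bdiag k m B C \<equiv> four_block_mat B (0\<^sub>m k m) (0\<^sub>m m k) C"

lemma bdiag_mult:
  assumes "B \<in> carrier_mat k k" "B' \<in> carrier_mat k k" "C \<in> carrier_mat m m" "C' \<in> carrier_mat m m"
  shows "bdiag k m B C * bdiag k m B' C' = bdiag k m (B * B') (C * C')"
  using assms by (subst mult_four_block_mat[of _ k k _ m _ m]) auto

lemma bdiag_minus: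
  assumes "B \<in> carrier_mat k k" "B' \<in> carrier_mat k k" "C \<in> carrier_mat m m" "C' \<in> carrier_mat m m"
  shows "bdiag k m B C - bdiag k m B' C' = bdiag k m (B - B') (C - C')"
  using assms by (intro eq_matI) auto

lemma bdiag_inj:
  assumes "B \<in> carrier_mat k k" "B' \<in> carrier_mat k k" "C \<in> carrier_mat m m" "C' \<in> carrier_mat m m"
  shows "bdiag k m B C = bdiag k m B' C' \<longleftrightarrow> B = B' \<and> C = C'"
proof
  assume eq: "bdiag k m B C = bdiag k m B' C'"
  have "B $$ (i,j) = B' $$ (i,j)" if "i < k" "j < k" for i j
    using arg_cong[OF eq, of "\<lambda>M. M $$ (i,j)"] assms that by simp
  moreover have "C $$ (i,j) = C' $$ (i,j)" if "i < m" "j < m" for i j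
    using arg_cong[OF eq, of "\<lambda>M. M $$ (i + k,j + k)"] assms that by simp
  ultimately show "B = B' \<and> C = C'" using assms by auto
qed auto

lemma hermitian_bdiag_iff:
  assumes "B \<in> carrier_mat k k" "C \<in> carrier_mat m m"
  shows "hermitian (bdiag k m B C) \<longleftrightarrow> hermitian B \<and> hermitian C"
  using assms bdiag_inj[of "mat_adjoint B" k B "mat_adjoint C" m C]
  by (simp add: hermitian_iff[of _ "k + m"] hermitian_iff[of B k] hermitian_iff[of C m]
      mat_adjoint_four_block)

lemma cscalar_prod_append:
  fixes u v :: "complex vec"
  assumes "u \<in> carrier_vec k" "u' \<in> carrier_vec k" "v \<in> carrier_vec m" "v' \<in> carrier_vec m"
  shows "(u @\<^sub>v v) \<bullet>c (u' @\<^sub>v v') = u \<bullet>c u' + v \<bullet>c v'"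
proof -
  have "conjugate (u' @\<^sub>v v') = conjugate u' @\<^sub>v conjugate v'"
    using assms by (intro eq_vecI) auto
  then show ?thesis using assms by (simp add: scalar_prod_append[of _ k _ m])
qed

lemma positive_bdiag_iff:
  assumes "B \<in> carrier_mat k k" "C \<in> carrier_mat m m"
  shows "positive_mat (bdiag k m B C) \<longleftrightarrow> positive_mat B \<and> positive_mat C"
proof -
  have form: "(bdiag k m B C *\<^sub>v (u @\<^sub>v v)) \<bullet>c (u @\<^sub>v v) = (B *\<^sub>v u) \<bullet>c u + (C *\<^sub>v v) \<bullet>c v"
    if "u \<in> carrier_vec k" "v \<in> carrier_vec m" for u v
    using assms that mult_mat_vec_split[OF assms that]
      mult_mat_vec_carrier[OF assms(1) that(1)] mult_mat_vec_carrier[OF assms(2) that(2)]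
    by (simp add: cscalar_prod_append[of _ k _ _ m])
  have "(\<forall>w \<in> carrier_vec (k + m). 0 \<le> (bdiag k m B C *\<^sub>v w) \<bullet>c w) \<longleftrightarrow>
    (\<forall>u \<in> carrier_vec k. 0 \<le> (B *\<^sub>v u) \<bullet>c u) \<and> (\<forall>v \<in> carrier_vec m. 0 \<le> (C *\<^sub>v v) \<bullet>c v)"
    (is "?L \<longleftrightarrow> ?R")
  proof
    assume L: ?L
    have "0 \<le> (B *\<^sub>v u) \<bullet>c u" if u: "u \<in> carrier_vec k" for u
      using L[rule_format, of "u @\<^sub>v 0\<^sub>v m"] form[OF u, of "0\<^sub>v m"] u assms by simp
    moreover have "0 \<le> (C *\<^sub>v v) \<bullet>c v" if v: "v \<in> carrier_vec m" for v
      using L[rule_format, of "0\<^sub>v k @\<^sub>v v"] form[of "0\<^sub>v k" v] v assms by simp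
    ultimately show ?R by simp
  next
    assume R: ?R
    show ?L
    proof
      fix w :: "complex vec" assume "w \<in> carrier_vec (k + m)"
      then have w: "w = vec_first w k @\<^sub>v vec_last w m" by simp
      show "0 \<le> (bdiag k m B C *\<^sub>v w) \<bullet>c w"
        by (subst (1 2) w, subst form) (use R in \<open>auto intro!: add_nonneg_nonneg\<close>)
    qed
  qed
  then show ?thesis using assms unfolding positive_mat_def
    by (auto simp: hermitian_bdiag_iff)
qed

lemma det_bdiag:
  assumes "B \<in> carrier_mat k k" "C \<in> carrier_mat m m"
  shows "det (bdiag k m B C) = det B * det C"
  using assms by (intro det_four_block_mat_upper_right_zero) auto

lemma unitary_bdiag:
  assumes "B \<in> carrier_mat k k" "C \<in> carrier_mat m m" "unitary_mat B" "unitary_mat C"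
  shows "unitary_mat (bdiag k m B C)"
proof (rule unitary_matI)
  show "mat_adjoint (bdiag k m B C) * bdiag k m B C = 1\<^sub>m (k + m)"
    using assms unitary_matD(1)[OF assms(3,1)] unitary_matD(1)[OF assms(4,2)]
    by (simp add: mat_adjoint_four_block bdiag_mult)
qed (use assms in auto)

lemma uconj_bdiag:
  assumes "V \<in> carrier_mat k k" "W \<in> carrier_mat m m" "B \<in> carrier_mat k k" "C \<in> carrier_mat m m"
  shows "uconj (bdiag k m V W) (bdiag k m B C) = bdiag k m (uconj V B) (uconj W C)"
  using assms unfolding uconj_def
  by (simp add: mat_adjoint_four_block bdiag_mult mult_carrier_mat[of _ k k] mult_carrier_mat[of _ m m])

text \<open>One \<open>W\<close> has to split \<open>a\<close>, \<open>b\<close> and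
  \<open>P\<close> simultaneously, hence the quantifier over \<open>A\<close> behind the choice of
  \<open>W\<close>. Invariance of the span is expressed by orthogonality to its complement, which
  makes the lower left block zero; the upper right block then vanishes because \<open>A\<close> is
  hermitian. The first block is given explicitly so that its entries can be computed later.\<close>

lemma orthonormal_block:
  assumes us: "orthonormal_list n us" "length us = k" "k + m = n"
  obtains W where "W \<in> carrier_mat n n" "unitary_mat W"
    "\<And>A. A \<in> carrier_mat n n \<Longrightarrow> hermitian A \<Longrightarrow>
      (\<And>j v. j < k \<Longrightarrow> v \<in> carrier_vec n \<Longrightarrow> (\<And>i. i < k \<Longrightarrow> us ! i \<bullet>c v = 0) \<Longrightarrow> (A *\<^sub>v us ! j) \<bullet>c v = 0) \<Longrightarrow>
      \<exists>C \<in> carrier_mat m m.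
        A = uconj W (bdiag k m (mat k k (\<lambda>(i,j). (A *\<^sub>v us ! j) \<bullet>c us ! i)) C)"
proof -
  obtain vs where vs: "orthonormal_list n (us @ vs)" "length us + length vs = n"
    using orthonormal_list_extend[OF us(1)] us(2,3) by auto
  define f where "f i = (us @ vs) ! i" for i
  have fc: "f i \<in> carrier_vec n" if "i < n" for i
    using vs that unfolding orthonormal_list_def f_def by (metis length_append nth_mem subsetD)
  have ff: "f i \<bullet>c f j = (if i = j then 1 else 0)" if "i < n" "j < n" for i j
    using vs that unfolding orthonormal_list_def f_def by simp
  have fu: "f i = us ! i" if "i < k" for i
    using that us by (simp add: f_def nth_append)
  \<comment> \<open>The columns are the completed orthonormal basis, so the entries of W* A W are
    the inner products of A f_j with f_i.\<close>
  define W where "W = mat n n (\<lambda>(i,j). f j $ i)"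
  have W: "W \<in> carrier_mat n n" by (simp add: W_def)
  have aW: "mat_adjoint W \<in> carrier_mat n n" using W by simp
  have entry: "(mat_adjoint W * (A * W)) $$ (i,j) = (A *\<^sub>v f j) \<bullet>c f i"
    if "i < n" "j < n" "A \<in> carrier_mat n n" for A i j
  proof -
    have "col W j = f j" using fc[OF that(2)] that by (intro eq_vecI) (auto simp: W_def)
    then have "col (A * W) j = A *\<^sub>v f j" using col_mult2[OF that(3) W that(2)] by simp
    moreover have "row (mat_adjoint W) i = conjugate (f i)"
      using fc[OF that(1)] that W by (intro eq_vecI) (auto simp: W_def)
    ultimately have "(mat_adjoint W * (A * W)) $$ (i,j) = conjugate (f i) \<bullet> (A *\<^sub>v f j)"
      using that W by simp
    then show ?thesis
      using comm_scalar_prod[of "conjugate (f i)" n "A *\<^sub>v f j"] that fc by simp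
  qed
  have "mat_adjoint W * W = 1\<^sub>m n"
  proof (rule eq_matI)
    fix i j assume "i < dim_row (1\<^sub>m n :: complex mat)" "j < dim_col (1\<^sub>m n :: complex mat)"
    then show "(mat_adjoint W * W) $$ (i, j) = 1\<^sub>m n $$ (i, j)"
      using entry[of i j "1\<^sub>m n"] ff[of j i] fc[of j] W by auto
  qed (use W in auto)
  then have uW: "unitary_mat W" by (rule unitary_matI[OF W])
  show ?thesis
  proof (rule that[OF W uW])
    fix A assume A: "A \<in> carrier_mat n n" "hermitian A"
      and inv: "\<And>j v. j < k \<Longrightarrow> v \<in> carrier_vec n \<Longrightarrow> (\<And>i. i < k \<Longrightarrow> us ! i \<bullet>c v = 0) \<Longrightarrow> (A *\<^sub>v us ! j) \<bullet>c v = 0"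
    define M where "M = mat_adjoint W * (A * W)"
    have M: "M \<in> carrier_mat n n" using A W aW by (simp add: M_def square_mult_closed[of _ n])
    have M_eq: "M = uconj (mat_adjoint W) A"
      using A W aW by (simp add: M_def uconj_def square_mult_assoc[of _ n] square_mult_closed[of _ n])
    have hM: "hermitian M"
      unfolding M_eq using hermitian_uconj_iff[OF unitary_mat_adjoint[OF uW] aW A(1)] A(2) by simp
    have Mij: "M $$ (i,j) = (A *\<^sub>v f j) \<bullet>c f i" if "i < n" "j < n" for i j
      unfolding M_def by (rule entry[OF that A(1)])
    have kn: "j < n" if "j < k" for j using that us(3) by simp
    have low: "M $$ (i,j) = 0" if "k \<le> i" "i < n" "j < k" for i j
    proof -
      have "us ! l \<bullet>c f i = 0" if "l < k" for l
        using ff[OF kn[OF that] \<open>i < n\<close>] fu[OF that] that \<open>k \<le> i\<close> by simp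
      then have "(A *\<^sub>v us ! j) \<bullet>c f i = 0"
        using that by (intro inv fc) auto
      then show ?thesis unfolding Mij[OF that(2) kn[OF that(3)]] fu[OF that(3)] .
    qed
    have up: "M $$ (i,j) = 0" if "i < k" "k \<le> j" "j < n" for i j
    proof -
      have "M $$ (i,j) = mat_adjoint M $$ (i,j)" using hM by (simp add: hermitian_def)
      also have "\<dots> = cnj (M $$ (j,i))" using M that us(3) by simp
      finally show ?thesis using low[of j i] that by simp
    qed
    define C where "C = mat m m (\<lambda>(i,j). M $$ (i + k, j + k))"
    have "M = bdiag k m (mat k k (\<lambda>(i,j). (A *\<^sub>v us ! j) \<bullet>c us ! i)) C"
    proof (rule eq_matI, goal_cases)
      case (1 i j)
      then have ij: "i < n" "j < n" using us(3) by (auto simp: C_def)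
      show ?case
      proof (cases "i < k"; cases "j < k")
        assume "i < k" "j < k"
        then show ?thesis unfolding Mij[OF ij] by (simp add: fu)
      next
        assume "i < k" "\<not> j < k"
        then show ?thesis using up[of i j] ij us(3) by (auto simp: C_def)
      next
        assume "\<not> i < k" "j < k"
        then show ?thesis using low[of i j] ij us(3) by (auto simp: C_def)
      next
        assume "\<not> i < k" "\<not> j < k"
        then show ?thesis using ij us(3) by (auto simp: C_def)
      qed
    qed (use M us(3) in \<open>auto simp: C_def\<close>)
    moreover have "A = uconj W M"
      unfolding M_eq using uconj_cancel(2)[OF uW W A(1)] by simp
    moreover have "C \<in> carrier_mat m m" by (simp add: C_def)
    ultimately show "\<exists>C \<in> carrier_mat m m.
        A = uconj W (bdiag k m (mat k k (\<lambda>(i,j). (A *\<^sub>v us ! j) \<bullet>c us ! i)) C)"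
      by metis
  qed
qed

section \<open>Square roots of positive matrices\<close>

lemma exists_unit_eigenvector:
  fixes A :: "complex mat"
  assumes "A \<in> carrier_mat n n" "n > 0"
  obtains v c where "v \<in> carrier_vec n" "v \<bullet>c v = 1" "A *\<^sub>v v = c \<cdot>\<^sub>v v"
proof -
  obtain c where "eigenvalue A c"
    using spectrum_non_empty[OF assms(1)] assms(2) unfolding spectrum_def by auto
  then obtain u where u: "u \<in> carrier_vec n" "u \<noteq> 0\<^sub>v n" "A *\<^sub>v u = c \<cdot>\<^sub>v u"
    using assms unfolding eigenvalue_def eigenvector_def by auto
  obtain d where d: "(d \<cdot>\<^sub>v u) \<bullet>c (d \<cdot>\<^sub>v u) = 1"
    using vec_normalize[OF u(1,2)] by blast
  have "A *\<^sub>v (d \<cdot>\<^sub>v u) = c \<cdot>\<^sub>v (d \<cdot>\<^sub>v u)"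
    using u assms by (simp add: mult_mat_vec[of _ n n] smult_smult_assoc mult.commute)
  with u d that[of "d \<cdot>\<^sub>v u" c] show ?thesis by simp
qed

text \<open>Induction on \<open>n\<close>: a unit eigenvector spans an invariant line, and the
  complementary block is again hermitian. The eigenvalues are recorded as a real-valued function so
  that absolute values and reciprocals can be taken on the diagonal.\<close>

lemma hermitian_spectral:
  assumes "A \<in> carrier_mat n n" "hermitian A"
  obtains W and f :: "nat \<Rightarrow> real" where "W \<in> carrier_mat n n" "unitary_mat W"
    "A = uconj W (mat_diag n (\<lambda>i. complex_of_real (f i)))"
proof -
  have "\<exists>W (f :: nat \<Rightarrow> real). W \<in> carrier_mat n n \<and> unitary_mat W \<and>
    A = uconj W (mat_diag n (\<lambda>i. complex_of_real (f i)))"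
    using assms
  proof (induction n arbitrary: A)
    case 0
    then show ?case
      by (intro exI[of _ "1\<^sub>m 0"] exI[of _ "\<lambda>_. 0"])
        (auto intro!: unitary_matI[of _ 0] simp: uconj_def)
  next
    case (Suc n)
    obtain u c where u: "u \<in> carrier_vec (Suc n)" "u \<bullet>c u = 1" "A *\<^sub>v u = c \<cdot>\<^sub>v u"
      using exists_unit_eigenvector[OF Suc.prems(1)] by blast
    have "u \<noteq> 0\<^sub>v (Suc n)" using u(1,2) cscalar_prod_self_eq_0[of u "Suc n"] by auto
    then have cr: "cnj c = c"
      using hermitian_real_eigenvalue[OF Suc.prems(2,1) u(1) _ u(3)] by blast
    have u1: "orthonormal_list (Suc n) [u]" "length [u] = 1" "1 + n = Suc n"
      using u by (simp_all add: orthonormal_list_def)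
    obtain W where
      W: "W \<in> carrier_mat (Suc n) (Suc n)" "unitary_mat W" and
      blk: "\<And>A. A \<in> carrier_mat (Suc n) (Suc n) \<Longrightarrow> hermitian A \<Longrightarrow>
      (\<And>j v. j < 1 \<Longrightarrow> v \<in> carrier_vec (Suc n) \<Longrightarrow> (\<And>i. i < 1 \<Longrightarrow> [u] ! i \<bullet>c v = 0) \<Longrightarrow> (A *\<^sub>v [u] ! j) \<bullet>c v = 0) \<Longrightarrow>
      \<exists>C \<in> carrier_mat n n.
        A = uconj W (bdiag 1 n (mat 1 1 (\<lambda>(i,j). (A *\<^sub>v [u] ! j) \<bullet>c [u] ! i)) C)"
      using orthonormal_block[OF u1] by metis
    define B where "B = mat 1 1 (\<lambda>(i,j). (A *\<^sub>v [u] ! j) \<bullet>c [u] ! i)"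
    have B: "B \<in> carrier_mat 1 1" by (simp add: B_def)
    have B00: "B $$ (0,0) = c" using u by (simp add: B_def cscalar_prod_add[of _ "Suc n"])
    obtain C where C: "C \<in> carrier_mat n n" "A = uconj W (bdiag 1 n B C)"
      unfolding B_def using blk[OF Suc.prems] u
      by (auto simp: cscalar_prod_add[of _ "Suc n"])
    have BC: "bdiag 1 n B C \<in> carrier_mat (Suc n) (Suc n)" using B C(1) by auto
    have "hermitian C"
      using Suc.prems(2) hermitian_uconj_iff[OF W(2,1) BC] hermitian_bdiag_iff[OF B C(1)] C(2) by simp
    from Suc.IH[OF C(1) this] obtain V and f :: "nat \<Rightarrow> real" where
      V: "V \<in> carrier_mat n n" "unitary_mat V" and
      Cf: "C = uconj V (mat_diag n (\<lambda>i. complex_of_real (f i)))" by blast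
    define V' where "V' = bdiag 1 n (1\<^sub>m 1) V"
    have V': "V' \<in> carrier_mat (Suc n) (Suc n)" "unitary_mat V'"
      using V unitary_bdiag[of "1\<^sub>m 1" 1 V n] unitary_matI[of "1\<^sub>m 1" 1] by (auto simp: V'_def)
    \<comment> \<open>The new eigenvalue occupies position 0 and the old ones move up by one.
      Passing to \<open>Re c\<close> loses nothing, as \<open>c\<close> is real.\<close>
    define g where "g = (\<lambda>i. case i of 0 \<Rightarrow> Re c | Suc j \<Rightarrow> f j)"
    have "complex_of_real (Re c) = c" using cr by (simp add: complex_eq_iff)
    then have diag: "bdiag 1 n B (mat_diag n (\<lambda>i. complex_of_real (f i)))
      = mat_diag (Suc n) (\<lambda>i. complex_of_real (g i))"
      using B B00 by (intro eq_matI) (auto simp: mat_diag_def g_def split: nat.splits)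
    have "bdiag 1 n B C = uconj V' (bdiag 1 n B (mat_diag n (\<lambda>i. complex_of_real (f i))))"
      unfolding V'_def Cf using B V
      by (subst uconj_bdiag) (auto simp: uconj_def)
    then have "A = uconj (W * V') (mat_diag (Suc n) (\<lambda>i. complex_of_real (g i)))"
      unfolding C(2) diag using uconj_uconj[OF W(1) V'(1)] by simp
    then show ?case
      using unitary_mat_mult[OF W(2) V'(2) W(1) V'(1)] square_mult_closed[OF W(1) V'(1)] by blast
  qed
  then show ?thesis using that by blast
qed

lemma positive_mat_diag:
  assumes "\<And>i. i < n \<Longrightarrow> f i \<ge> 0"
  shows "positive_mat (mat_diag n (\<lambda>i. complex_of_real (f i)))"
proof -
  let ?D = "mat_diag n (\<lambda>i. complex_of_real (f i))"
  have "0 \<le> (?D *\<^sub>v v) \<bullet>c v" if v: "v \<in> carrier_vec n" for v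
  proof -
    have "(?D *\<^sub>v v) $ i = complex_of_real (f i) * v $ i" if "i < n" for i
    proof -
      have "(?D *\<^sub>v v) $ i = (\<Sum>j<n. (if i = j then complex_of_real (f j) else 0) * v $ j)"
        using that v by (auto simp: mat_diag_def scalar_prod_def atLeast0LessThan intro!: sum.cong)
      also have "\<dots> = (\<Sum>j<n. if i = j then complex_of_real (f j) * v $ j else 0)"
        by (intro sum.cong) auto
      also have "\<dots> = complex_of_real (f i) * v $ i" using that by simp
      finally show ?thesis .
    qed
    then have "(?D *\<^sub>v v) \<bullet>c v = (\<Sum>i<n. complex_of_real (f i) * (v $ i * cnj (v $ i)))"
      using v by (simp add: cscalar_prod_sum[of _ n] mult.assoc)
    also have "\<dots> = complex_of_real (\<Sum>i<n. f i * (cmod (v $ i))\<^sup>2)"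
      by (simp only: complex_norm_square of_real_sum of_real_mult)
    also have "\<dots> \<ge> 0"
      using assms by (auto simp: less_eq_complex_def intro!: sum_nonneg)
    finally show ?thesis .
  qed
  moreover have "hermitian ?D" by (simp add: hermitian_iff[of _ n] mat_adjoint_mat_diag)
  ultimately show ?thesis by (simp add: positive_mat_def mat_diag_def)
qed

text \<open>If \<open>v\<close> is an eigenvector of \<open>D = Y - Z\<close> for \<open>c\<close>, then \<open>YD + DZ = Y\<^sup>2 - Z\<^sup>2 = 0\<close> yields
  \<open>c (\<langle>Yv,v\<rangle> + \<langle>Zv,v\<rangle>) = 0\<close>, and positivity forces \<open>c = 0\<close>.\<close>

lemma positive_sqrt_unique:
  assumes Y: "Y \<in> carrier_mat n n" "positive_mat Y" and Z: "Z \<in> carrier_mat n n" "positive_mat Z"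
    and eq: "Y * Y = Z * Z"
  shows "Y = Z"
proof -
  define D where "D = Y - Z"
  have D: "D \<in> carrier_mat n n" "hermitian D"
    using Y Z hermitian_minus[of Y n Z] by (auto simp: D_def positive_mat_def)
  obtain W and f :: "nat \<Rightarrow> real" where W: "W \<in> carrier_mat n n" "unitary_mat W"
    and Df: "D = uconj W (mat_diag n (\<lambda>i. complex_of_real (f i)))"
    using hermitian_spectral[OF D] by blast
  have aW: "mat_adjoint W \<in> carrier_mat n n" using W by simp
  have "f i = 0" if i: "i < n" for i
  proof (rule ccontr)
    assume fi: "f i \<noteq> 0"
    let ?c = "complex_of_real (f i)"
    \<comment> \<open>Column \<open>i\<close> of \<open>W\<close> is an eigenvector of
      \<open>D\<close> for the eigenvalue \<open>f i\<close>.\<close>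
    define v where "v = W *\<^sub>v unit_vec n i"
    have v: "v \<in> carrier_vec n" using W by (simp add: v_def)
    have Wv: "mat_adjoint W *\<^sub>v v = unit_vec n i"
      unfolding v_def using W aW unitary_matD[OF W(2,1)]
      by (simp flip: assoc_mult_mat_vec[of _ n n _ n])
    have v0: "v \<noteq> 0\<^sub>v n"
    proof
      assume "v = 0\<^sub>v n"
      moreover have "mat_adjoint W *\<^sub>v 0\<^sub>v n = 0\<^sub>v n" using W by (intro eq_vecI) auto
      ultimately have "unit_vec n i = (0\<^sub>v n :: complex vec)" using Wv by simp
      then have "unit_vec n i $ i = (0 :: complex)" using i by simp
      then show False using i by simp
    qed
    have "mat_diag n (\<lambda>i. complex_of_real (f i)) *\<^sub>v unit_vec n i = ?c \<cdot>\<^sub>v unit_vec n i"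
      using i by (intro eq_vecI) (auto simp: mat_diag_def)
    then have "D *\<^sub>v v = W *\<^sub>v (?c \<cdot>\<^sub>v unit_vec n i)"
      unfolding Df uconj_def using W aW v Wv
      by (simp add: assoc_mult_mat_vec[of _ n n _ n] square_mult_closed[of _ n])
    then have Dv: "D *\<^sub>v v = ?c \<cdot>\<^sub>v v" using W by (simp add: v_def mult_mat_vec[of _ n n])
    have c: "Y *\<^sub>v v \<in> carrier_vec n" "Z *\<^sub>v v \<in> carrier_vec n" using Y Z v by auto
    have Deq: "D *\<^sub>v u = Y *\<^sub>v u - Z *\<^sub>v u" if "u \<in> carrier_vec n" for u
      unfolding D_def using Y Z that by (simp add: minus_mult_distrib_mat_vec[of _ n n])
    have YY: "Y *\<^sub>v (Y *\<^sub>v v) = Z *\<^sub>v (Z *\<^sub>v v)"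
      by (simp only: assoc_mult_mat_vec[OF Y(1) Y(1) v, symmetric]
          assoc_mult_mat_vec[OF Z(1) Z(1) v, symmetric] eq)
    have "?c * ((Y *\<^sub>v v) \<bullet>c v) = (Y *\<^sub>v (D *\<^sub>v v)) \<bullet>c v"
      unfolding Dv using Y v c by (simp add: mult_mat_vec[of _ n n] cscalar_prod_add[of _ n])
    also have "\<dots> = (Y *\<^sub>v (Y *\<^sub>v v)) \<bullet>c v - (Y *\<^sub>v (Z *\<^sub>v v)) \<bullet>c v"
      unfolding Deq[OF v] using Y v c
      by (simp add: mult_minus_distrib_mat_vec[of _ n n] cscalar_prod_add[of _ n])
    also have "\<dots> = - ((D *\<^sub>v (Z *\<^sub>v v)) \<bullet>c v)"
      unfolding Deq[OF c(2)] YY using Y Z v c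
      by (simp add: mult_minus_distrib_mat_vec[of _ n n] cscalar_prod_add[of _ n])
    also have "(D *\<^sub>v (Z *\<^sub>v v)) \<bullet>c v = ?c * ((Z *\<^sub>v v) \<bullet>c v)"
      unfolding hermitian_cscalar[OF D(2,1) c(2) v] Dv using c v by (simp add: cscalar_prod_add[of _ n])
    finally have "?c * ((Y *\<^sub>v v) \<bullet>c v + (Z *\<^sub>v v) \<bullet>c v) = 0" by (simp add: distrib_left)
    then have "(Y *\<^sub>v v) \<bullet>c v + (Z *\<^sub>v v) \<bullet>c v = 0" using fi by simp
    moreover have "0 \<le> (Y *\<^sub>v v) \<bullet>c v" "0 \<le> (Z *\<^sub>v v) \<bullet>c v"
      using Y Z v by (auto simp: positive_mat_def)
    ultimately have z: "(Y *\<^sub>v v) \<bullet>c v = 0" "(Z *\<^sub>v v) \<bullet>c v = 0"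
      using add_nonneg_eq_0_iff by blast+
    \<comment> \<open>Both quadratic forms vanish at \<open>v\<close>, hence so does that of their
      difference \<open>D\<close>; but its value is \<open>f i\<close> times the squared norm of
      \<open>v\<close>.\<close>
    have "?c * (v \<bullet>c v) = (D *\<^sub>v v) \<bullet>c v" unfolding Dv using v by (simp add: cscalar_prod_add[of _ n])
    also have "\<dots> = 0" unfolding Deq[OF v] using z c v by (simp add: cscalar_prod_add[of _ n])
    finally show False using fi v0 cscalar_prod_self_eq_0[OF v] by simp
  qed
  then have "mat_diag n (\<lambda>i. complex_of_real (f i)) = 0\<^sub>m n n"
    by (intro eq_matI) (auto simp: mat_diag_def)
  then have "D = 0\<^sub>m n n" using Df W aW by (simp add: uconj_def)
  then have "D $$ (i,j) = 0" if "i < n" "j < n" for i j using that by simp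
  then show "Y = Z" unfolding D_def using Y(1) Z(1) by (intro eq_matI) auto
qed

text \<open>Take absolute values of the eigenvalues. Commutation with \<open>A\<close> is evident
  for this particular root; by uniqueness it carries over to any positive \<open>P\<close> with P^2
  = A^2, for which no diagonal form is at hand.\<close>

lemma hermitian_abs_exists:
  assumes "A \<in> carrier_mat n n" "hermitian A"
  obtains Q where "Q \<in> carrier_mat n n" "positive_mat Q" "Q * Q = A * A" "Q * A = A * Q"
proof -
  obtain W and f :: "nat \<Rightarrow> real" where W: "W \<in> carrier_mat n n" "unitary_mat W"
    and Af: "A = uconj W (mat_diag n (\<lambda>i. complex_of_real (f i)))"
    using hermitian_spectral[OF assms] by blast
  define Q where "Q = uconj W (mat_diag n (\<lambda>i. complex_of_real \<bar>f i\<bar>))"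
  have "Q \<in> carrier_mat n n" using W by (simp add: Q_def)
  moreover have "positive_mat Q"
    unfolding Q_def using W by (intro positive_uconj positive_mat_diag) auto
  moreover have "Q * Q = A * A" "Q * A = A * Q"
    unfolding Q_def Af using W by (simp_all add: uconj_mult[of _ n] mult.commute flip: of_real_mult)
  ultimately show ?thesis using that by blast
qed

lemma positive_sqrt_commute:
  assumes "A \<in> carrier_mat n n" "hermitian A" "P \<in> carrier_mat n n" "positive_mat P" "P * P = A * A"
  shows "P * A = A * P"
  using hermitian_abs_exists[OF assms(1,2)] positive_sqrt_unique[OF assms(3,4)] assms(5) by metis

lemma mat_abs_eq:
  assumes "A \<in> carrier_mat n n" "hermitian A" "P \<in> carrier_mat n n" "positive_mat P" "P * P = A * A"
  shows "mat_abs A = P"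
proof -
  have "mat_adjoint A * A = A * A" using assms(2) by (simp add: hermitian_def)
  then have "mat_abs A = (THE y. positive_mat y \<and> dim_row y = n \<and> y * y = A * A)"
    using assms(1) unfolding mat_abs_def mat_sqrt_def by simp
  also have "\<dots> = P"
  proof (rule the_equality)
    show "positive_mat P \<and> dim_row P = n \<and> P * P = A * A" using assms by auto
    fix y assume y: "positive_mat y \<and> dim_row y = n \<and> y * y = A * A"
    then have "y \<in> carrier_mat n n" by (metis positive_mat_def hermitian_def)
    then show "y = P" using positive_sqrt_unique[of y n P] y assms by simp
  qed
  finally show ?thesis .
qed

text \<open>This removes the definite descriptions. Forwards, the witness is \<open>|a - b|\<close>,
  and compatibility makes its complement equal to \<open>|1 - a - b|\<close>; backwards, uniqueness
  of positive square roots identifies \<open>P\<close> and its complement with these absolute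
  values.\<close>

lemma abs_compatible_iff:
  assumes a: "a \<in> carrier_mat n n" "hermitian a" and b: "b \<in> carrier_mat n n" "hermitian b"
  shows "abs_compatible a b \<longleftrightarrow> (\<exists>P \<in> carrier_mat n n. positive_mat P \<and> positive_mat (1\<^sub>m n - P) \<and>
    P * P = (a - b) * (a - b) \<and> (1\<^sub>m n - P) * (1\<^sub>m n - P) = (1\<^sub>m n - a - b) * (1\<^sub>m n - a - b))"
    (is "_ \<longleftrightarrow> ?R")
proof -
  define x where "x = a - b"
  define y where "y = 1\<^sub>m n - a - b"
  have x: "x \<in> carrier_mat n n" "hermitian x"
    using a b hermitian_minus[of a n b] by (auto simp: x_def)
  have y: "y \<in> carrier_mat n n" "hermitian y"
    using a b hermitian_minus[of "1\<^sub>m n" n a] hermitian_minus[of "1\<^sub>m n - a" n b] hermitian_one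
      minus_carrier_mat[OF a(1)] minus_carrier_mat[OF b(1)]
    by (simp_all add: y_def)
  obtain Q where Q: "Q \<in> carrier_mat n n" "positive_mat Q" "Q * Q = x * x"
    using hermitian_abs_exists[OF x] by blast
  obtain R where R: "R \<in> carrier_mat n n" "positive_mat R" "R * R = y * y"
    using hermitian_abs_exists[OF y] by blast
  have ac: "abs_compatible a b \<longleftrightarrow> Q + R = 1\<^sub>m n"
    using mat_abs_eq[OF x Q] mat_abs_eq[OF y R] a unfolding abs_compatible_def x_def y_def by simp
  show ?thesis
  proof
    assume "abs_compatible a b"
    then have eq: "Q + R = 1\<^sub>m n" using ac by simp
    have "R $$ (i,j) = (1\<^sub>m n - Q) $$ (i,j)" if "i < n" "j < n" for i j
      using arg_cong[OF eq, of "\<lambda>M. M $$ (i,j)"] that Q R by (auto simp: algebra_simps)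
    then have "R = 1\<^sub>m n - Q" using Q R by (intro eq_matI) auto
    then show ?R using Q R unfolding x_def y_def by auto
  next
    assume ?R
    then obtain P where P: "P \<in> carrier_mat n n" "positive_mat P" "positive_mat (1\<^sub>m n - P)"
      "P * P = x * x" "(1\<^sub>m n - P) * (1\<^sub>m n - P) = y * y" unfolding x_def y_def by blast
    have "Q = P" using positive_sqrt_unique[OF Q(1,2) P(1,2)] Q P by simp
    moreover have "R = 1\<^sub>m n - P"
      using positive_sqrt_unique[OF R(1,2) minus_carrier_mat[OF P(1)] P(3)] R P by simp
    ultimately show "abs_compatible a b"
      unfolding ac using P(1) by (intro eq_matI) auto
  qed
qed

section \<open>Range projections and strictness\<close>

text \<open>The witness is the spectral projection onto the nonzero eigenvalues. Before anything can
  be read off from the definite description, uniqueness is required: a hermitian idempotent is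
  determined by its range.\<close>

lemma range_proj_props:
  assumes a: "a \<in> carrier_mat n n" "hermitian a"
  shows "range_proj a \<in> carrier_mat n n" "mat_range (range_proj a) = mat_range a"
proof -
  obtain W and f :: "nat \<Rightarrow> real" where W: "W \<in> carrier_mat n n" "unitary_mat W"
    and af: "a = uconj W (mat_diag n (\<lambda>i. complex_of_real (f i)))"
    using hermitian_spectral[OF a] by blast
  define p where "p = uconj W (mat_diag n (\<lambda>i. if f i = 0 then 0 else 1))"
  \<comment> \<open>A pseudo-inverse of \<open>a\<close>: division by zero yields 0, so the product
    of \<open>a\<close> and \<open>g\<close> has 1 at the nonzero eigenvalues and 0 at the
    others.\<close>
  define g where "g = uconj W (mat_diag n (\<lambda>i. 1 / complex_of_real (f i)))"
  have c: "p \<in> carrier_mat n n" "g \<in> carrier_mat n n" using W by (auto simp: p_def g_def)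
  have ag: "a * g = p"
    unfolding af p_def g_def using W
    by (auto simp: uconj_mult[of _ n] intro!: arg_cong[of _ _ "uconj W"] arg_cong[of _ _ "mat_diag n"])
  have pa: "p * a = a"
    unfolding af p_def using W
    by (auto simp: uconj_mult[of _ n] intro!: arg_cong[of _ _ "uconj W"] arg_cong[of _ _ "mat_diag n"])
  have pp: "p * p = p"
    unfolding p_def using W
    by (auto simp: uconj_mult[of _ n] intro!: arg_cong[of _ _ "uconj W"] arg_cong[of _ _ "mat_diag n"])
  have ph: "mat_adjoint p = p"
    unfolding p_def using W
    by (auto simp: uconj_adjoint[of _ n] mat_adjoint_mat_diag intro!: arg_cong[of _ _ "uconj W"] arg_cong[of _ _ "mat_diag n"])
  have r: "mat_range p = mat_range a"
  proof (intro equalityI subsetI)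
    fix u assume "u \<in> mat_range p"
    then obtain v where v: "v \<in> carrier_vec n" "u = p *\<^sub>v v" using c by (auto simp: mat_range_def)
    then have "u = a *\<^sub>v (g *\<^sub>v v)" 
      by (simp only: assoc_mult_mat_vec[OF a(1) c(2) v(1), symmetric] ag)
    then show "u \<in> mat_range a" using v a c by (auto simp: mat_range_def)
  next
    fix u assume "u \<in> mat_range a"
    then obtain v where v: "v \<in> carrier_vec n" "u = a *\<^sub>v v" using a by (auto simp: mat_range_def)
    then have "u = p *\<^sub>v (a *\<^sub>v v)" 
      by (simp only: assoc_mult_mat_vec[OF c(1) a(1) v(1), symmetric] pa)
    then show "u \<in> mat_range p" using v a c by (auto simp: mat_range_def)
  qed
  define Pr where "Pr q \<longleftrightarrow> q \<in> carrier_mat n n \<and> q * q = q \<and> mat_adjoint q = q \<and> mat_range q = mat_range a" for q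
  \<comment> \<open>The columns of \<open>q'\<close> lie in the common range, on which the
    idempotent \<open>q\<close> acts as the identity.\<close>
  have absorb: "q * q' = q'" if "Pr q" "Pr q'" for q q'
  proof -
    have qc: "q \<in> carrier_mat n n" "q' \<in> carrier_mat n n" using that by (auto simp: Pr_def)
    have "col (q * q') j = col q' j" if j: "j < n" for j
    proof -
      have "q' *\<^sub>v unit_vec n j \<in> mat_range q'" using qc by (auto simp: mat_range_def)
      then have "q' *\<^sub>v unit_vec n j \<in> mat_range q"
        using \<open>Pr q\<close> \<open>Pr q'\<close> unfolding Pr_def by simp
      then obtain v where v: "v \<in> carrier_vec n" "q' *\<^sub>v unit_vec n j = q *\<^sub>v v"
        using qc by (auto simp: mat_range_def)
      have cj: "col q' j = q' *\<^sub>v unit_vec n j"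
        using qc j by (intro eq_vecI) auto
      have "col (q * q') j = q *\<^sub>v (q *\<^sub>v v)"
        unfolding col_mult2[OF qc j] cj v(2) by (rule refl)
      also have "\<dots> = (q * q) *\<^sub>v v" using qc v by simp
      also have "\<dots> = col q' j" using \<open>Pr q\<close> v cj unfolding Pr_def by simp
      finally show ?thesis .
    qed
    then show ?thesis using qc by (intro mat_col_eqI) auto
  qed
  have "\<exists>!q. Pr q"
  proof (rule ex1I[of _ p])
    show Prp: "Pr p" using c pp ph r by (simp add: Pr_def)
    fix q assume q: "Pr q"
    \<comment> \<open>Absorption gives pq = q and qp = p; taking adjoints in the first turns it into
      qp = q.\<close>
    have "q = mat_adjoint (p * q)" using absorb[OF Prp q] q by (simp add: Pr_def)
    also have "\<dots> = q * p" using q c ph mat_adjoint_mult[of p n n q n] by (simp add: Pr_def)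
    finally show "q = p" using absorb[OF q Prp] by simp
  qed
  then have "Pr (THE q. Pr q)" by (rule theI')
  moreover have "range_proj a = (THE q. Pr q)" using a unfolding range_proj_def Pr_def by simp
  ultimately show "range_proj a \<in> carrier_mat n n" "mat_range (range_proj a) = mat_range a"
    by (auto simp: Pr_def)
qed

text \<open>A full range projection makes \<open>a\<close> surjective. A kernel vector v would then
  be v = aw, and (v, v) = (w, av) = 0 because the kernel of a hermitian matrix is orthogonal to its
  range.\<close>

lemma det_nonzero_of_range_proj:
  assumes a: "a \<in> carrier_mat n n" "hermitian a" and z: "1\<^sub>m n - range_proj a = 0\<^sub>m n n"
  shows "det a \<noteq> 0"
proof
  assume "det a = 0"
  then obtain v where v: "v \<in> carrier_vec n" "v \<noteq> 0\<^sub>v n" "a *\<^sub>v v = 0\<^sub>v n"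
    using det_0_iff_vec_prod_zero[OF a(1)] by auto
  note rp = range_proj_props[OF a]
  have "range_proj a $$ (i,j) = 1\<^sub>m n $$ (i,j)" if "i < n" "j < n" for i j
    using arg_cong[OF z, of "\<lambda>M. M $$ (i,j)"] that rp(1) by auto
  then have "range_proj a = 1\<^sub>m n" using rp(1) by (intro eq_matI) auto
  moreover have "v \<in> mat_range (1\<^sub>m n)"
    using v(1) unfolding mat_range_def by (auto intro!: exI[of _ v])
  ultimately have "v \<in> mat_range a" using rp(2) by simp
  then obtain w where w: "w \<in> carrier_vec n" "v = a *\<^sub>v w" using a by (auto simp: mat_range_def)
  have "v \<bullet>c v = w \<bullet>c (a *\<^sub>v v)" using hermitian_cscalar[OF a(2,1) w(1) v(1)] w(2) by simp
  also have "\<dots> = 0" using v w by simp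
  finally show False using v cscalar_prod_self_eq_0[OF v(1)] by simp
qed

text \<open>The conditions n(a) = 0 and s(a) = 0 say that 0 and 1 are not eigenvalues of
  \<open>a\<close>. Determinants are the handy form, being invariant under conjugation and
  multiplicative over blocks.\<close>

lemma strict_det:
  assumes a: "a \<in> carrier_mat n n" "strict a"
  shows "det a \<noteq> 0" "det (1\<^sub>m n - a) \<noteq> 0"
proof -
  have h: "hermitian a" "hermitian (1\<^sub>m n - a)" "1\<^sub>m n - a \<in> carrier_mat n n"
    using a by (auto simp: strict_def effect_def positive_mat_def)
  have "1\<^sub>m n - range_proj a = 0\<^sub>m n n" "1\<^sub>m n - range_proj (1\<^sub>m n - a) = 0\<^sub>m n n"
    using a by (auto simp: strict_def s_proj_def n_proj_def)
  then show "det a \<noteq> 0" "det (1\<^sub>m n - a) \<noteq> 0"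
    using det_nonzero_of_range_proj a h by auto
qed

section \<open>Common eigenvectors and invariant planes\<close>

lemma smult_eq_imp_eq:
  fixes v :: "complex vec"
  assumes "v \<in> carrier_vec n" "v \<noteq> 0\<^sub>v n" "c \<cdot>\<^sub>v v = d \<cdot>\<^sub>v v"
  shows "c = d"
proof -
  have "c * (v \<bullet>c v) = d * (v \<bullet>c v)"
    using arg_cong[OF assms(3), of "\<lambda>u. u \<bullet>c v"] by (simp only: cscalar_prod_add(5)[OF assms(1,1,1)])
  then show ?thesis using assms cscalar_prod_self_eq_0[of v n] by simp
qed

lemma vec_minus_eq_0:
  fixes u v :: "'a :: ring vec"
  assumes "u \<in> carrier_vec n" "v \<in> carrier_vec n" "u - v = 0\<^sub>v n"
  shows "u = v"
proof (rule eq_vecI)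
  fix i assume "i < dim_vec v"
  then show "u $ i = v $ i" using assms(1,2) arg_cong[OF assms(3), of "\<lambda>z. z $ i"] by simp
qed (use assms in auto)

text \<open>For commuting hermitian \<open>A\<close>, \<open>B\<close> the matrix \<open>A + iB\<close> is normal; the real and imaginary parts of
  one of its eigenvalues are eigenvalues of \<open>A\<close> and \<open>B\<close> for the same vector.\<close>

lemma commuting_hermitian_common_eigenvector:
  assumes A: "A \<in> carrier_mat n n" "hermitian A" and B: "B \<in> carrier_mat n n" "hermitian B"
    and comm: "A * B = B * A" and n: "n > 0"
  obtains v and s r :: real where "v \<in> carrier_vec n" "v \<bullet>c v = 1"
    "A *\<^sub>v v = complex_of_real s \<cdot>\<^sub>v v" "B *\<^sub>v v = complex_of_real r \<cdot>\<^sub>v v"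
proof -
  have N: "A + \<i> \<cdot>\<^sub>m B \<in> carrier_mat n n" using A B by simp
  obtain v c where v: "v \<in> carrier_vec n" "v \<bullet>c v = 1" and Nv: "(A + \<i> \<cdot>\<^sub>m B) *\<^sub>v v = c \<cdot>\<^sub>v v"
    using exists_unit_eigenvector[OF N n] by blast
  define s r where "s = complex_of_real (Re c)" and "r = complex_of_real (Im c)"
  have sr: "cnj s = s" "cnj r = r" "c = s + \<i> * r"
    by (simp_all add: s_def r_def complex_eq_iff)
  have c: "A *\<^sub>v v \<in> carrier_vec n" "B *\<^sub>v v \<in> carrier_vec n" using A B v by simp_all
  \<comment> \<open>These are the defects in the two desired eigenvalue equations. The single
    equation for A + iB only says that u + iw = 0.\<close>
  define u w where "u = A *\<^sub>v v - s \<cdot>\<^sub>v v" and "w = B *\<^sub>v v - r \<cdot>\<^sub>v v"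
  have uw: "u \<in> carrier_vec n" "w \<in> carrier_vec n" using c v by (simp_all add: u_def w_def)
  have u_eq: "u = (- \<i>) \<cdot>\<^sub>v w"
  proof (rule eq_vecI)
    fix k assume "k < dim_vec ((- \<i>) \<cdot>\<^sub>v w)"
    then have k: "k < n" using uw by simp
    have "(A *\<^sub>v v) $ k + \<i> * (B *\<^sub>v v) $ k = ((A + \<i> \<cdot>\<^sub>m B) *\<^sub>v v) $ k"
      using k A B v
      by (simp add: scalar_prod_def sum.distrib sum_distrib_left algebra_simps)
    also have "\<dots> = s * v $ k + \<i> * r * v $ k"
      unfolding Nv sr(3) using k v by (simp add: algebra_simps)
    finally have "(A *\<^sub>v v) $ k - s * v $ k = - \<i> * ((B *\<^sub>v v) $ k - r * v $ k)"
      by (simp add: algebra_simps)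
    then show "u $ k = ((- \<i>) \<cdot>\<^sub>v w) $ k"
      using k c v by (simp add: u_def w_def)
  qed (use uw in auto)
  have "(A *\<^sub>v v) \<bullet>c (B *\<^sub>v v) = (B *\<^sub>v (A *\<^sub>v v)) \<bullet>c v"
    using hermitian_cscalar[OF B(2,1) c(1) v(1)] by simp
  also have "\<dots> = (A *\<^sub>v (B *\<^sub>v v)) \<bullet>c v"
    by (simp only: assoc_mult_mat_vec[OF A(1) B(1) v(1), symmetric]
        assoc_mult_mat_vec[OF B(1) A(1) v(1), symmetric] comm)
  also have "\<dots> = (B *\<^sub>v v) \<bullet>c (A *\<^sub>v v)"
    using hermitian_cscalar[OF A(2,1) c(2) v(1)] by simp
  finally have AB: "(A *\<^sub>v v) \<bullet>c (B *\<^sub>v v) = (B *\<^sub>v v) \<bullet>c (A *\<^sub>v v)" .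
  \<comment> \<open>Commutation of \<open>A\<close> and \<open>B\<close> enters here: it makes the
    inner product of \<open>u\<close> and \<open>w\<close> symmetric, hence real.\<close>
  have "u \<bullet>c w = w \<bullet>c u"
    unfolding u_def w_def using v c sr AB
      hermitian_cscalar[OF A(2,1) v(1) v(1)] hermitian_cscalar[OF B(2,1) v(1) v(1)]
    by (simp add: cscalar_prod_add[of _ n] minus_carrier_vec[of _ n] smult_carrier_vec[of _ _ n] algebra_simps)
  then have uw_real: "cnj (u \<bullet>c w) = u \<bullet>c w" using cscalar_prod_cnj[OF uw] by simp
  \<comment> \<open>A squared norm is real, yet here it is i times a real number, so it must be
    zero.\<close>
  have uu: "u \<bullet>c u = \<i> * (u \<bullet>c w)"
    by (subst (2) u_eq) (use uw in \<open>simp add: cscalar_prod_add(6)[OF uw(2) _ uw(1)]\<close>)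
  have "cnj (u \<bullet>c u) = u \<bullet>c u" using cscalar_prod_cnj[OF uw(1) uw(1)] by simp
  then have "u \<bullet>c u = 0" unfolding uu using uw_real by simp
  then have u0: "u = 0\<^sub>v n" using cscalar_prod_self_eq_0[OF uw(1)] by simp
  have "w = \<i> \<cdot>\<^sub>v u" unfolding u_eq using uw by (simp add: smult_smult_assoc)
  then have w0: "w = 0\<^sub>v n" unfolding u0 by auto
  have "A *\<^sub>v v = s \<cdot>\<^sub>v v" "B *\<^sub>v v = r \<cdot>\<^sub>v v"
    using vec_minus_eq_0[OF c(1) _ u0[unfolded u_def]] vec_minus_eq_0[OF c(2) _ w0[unfolded w_def]] v
    by simp_all
  then show ?thesis using that v unfolding s_def r_def by blast
qed

text \<open>A certificate of absolute compatibility (\<open>P = |a - b|\<close>) that, unlike square roots,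
  visibly passes to blocks. The determinants express strictness of \<open>a\<close> and \<open>b\<close>.\<close>

definition strictly_compatible :: "nat \<Rightarrow> complex mat \<Rightarrow> complex mat \<Rightarrow> complex mat \<Rightarrow> bool" where
  "strictly_compatible n a b P \<longleftrightarrow>
     a \<in> carrier_mat n n \<and> b \<in> carrier_mat n n \<and> P \<in> carrier_mat n n \<and>
     positive_mat a \<and> positive_mat (1\<^sub>m n - a) \<and> positive_mat b \<and> positive_mat (1\<^sub>m n - b) \<and>
     positive_mat P \<and> positive_mat (1\<^sub>m n - P) \<and>
     P * P = (a - b) * (a - b) \<and>
     (1\<^sub>m n - P) * (1\<^sub>m n - P) = (1\<^sub>m n - a - b) * (1\<^sub>m n - a - b) \<and>
     det a \<noteq> 0 \<and> det (1\<^sub>m n - a) \<noteq> 0 \<and> det b \<noteq> 0 \<and> det (1\<^sub>m n - b) \<noteq> 0"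

lemma strictly_compatible_uconj:
  assumes W: "W \<in> carrier_mat n n" "unitary_mat W"
    and c: "a \<in> carrier_mat n n" "b \<in> carrier_mat n n" "P \<in> carrier_mat n n"
  shows "strictly_compatible n (uconj W a) (uconj W b) (uconj W P) \<longleftrightarrow> strictly_compatible n a b P"
proof -
  let ?I = "1\<^sub>m n :: complex mat"
  have cc: "?I \<in> carrier_mat n n" "?I - a \<in> carrier_mat n n" "?I - b \<in> carrier_mat n n"
    "?I - P \<in> carrier_mat n n" "a - b \<in> carrier_mat n n" "?I - a - b \<in> carrier_mat n n"
    using c minus_carrier_mat by auto
  have one: "?I = uconj W ?I" using uconj_one W by simp
  have e: "?I - uconj W X = uconj W (?I - X)" if "X \<in> carrier_mat n n" for X
    by (subst one) (rule uconj_minus[OF W(1) cc(1) that])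
  have s: "uconj W (X * X) = uconj W (Y * Y) \<longleftrightarrow> X * X = Y * Y"
    if "X \<in> carrier_mat n n" "Y \<in> carrier_mat n n" for X Y
    using uconj_inj[OF W(2,1)] that by simp
  show ?thesis
    unfolding strictly_compatible_def
    using c cc W
    by (simp add: e uconj_minus[OF W(1)] uconj_mult[OF W(2,1)] s
        positive_uconj_iff[OF W(2,1)] det_uconj[OF W(2,1)])
qed

text \<open>Each clause splits over the blocks: the equations of squares and the positivity
  conditions blockwise, and the determinants because a product is nonzero exactly when both factors
  are.\<close>

lemma strictly_compatible_bdiag:
  assumes c: "a \<in> carrier_mat k k" "b \<in> carrier_mat k k" "P \<in> carrier_mat k k"
    and c': "a' \<in> carrier_mat m m" "b' \<in> carrier_mat m m" "P' \<in> carrier_mat m m"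
  shows "strictly_compatible (k + m) (bdiag k m a a') (bdiag k m b b') (bdiag k m P P') \<longleftrightarrow>
    strictly_compatible k a b P \<and> strictly_compatible m a' b' P'"
proof -
  have cc: "1\<^sub>m k - a \<in> carrier_mat k k" "1\<^sub>m k - b \<in> carrier_mat k k"
    "1\<^sub>m k - P \<in> carrier_mat k k" "a - b \<in> carrier_mat k k" "1\<^sub>m k - a - b \<in> carrier_mat k k"
    "1\<^sub>m m - a' \<in> carrier_mat m m" "1\<^sub>m m - b' \<in> carrier_mat m m"
    "1\<^sub>m m - P' \<in> carrier_mat m m" "a' - b' \<in> carrier_mat m m" "1\<^sub>m m - a' - b' \<in> carrier_mat m m"
    using c c' minus_carrier_mat by auto
  have e: "1\<^sub>m (k + m) - bdiag k m X Y = bdiag k m (1\<^sub>m k - X) (1\<^sub>m m - Y)"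
    if "X \<in> carrier_mat k k" "Y \<in> carrier_mat m m" for X Y
    using bdiag_minus[of "1\<^sub>m k" k X "1\<^sub>m m" m Y] that by simp
  have s: "bdiag k m (X * X) (Y * Y) = bdiag k m (X' * X') (Y' * Y') \<longleftrightarrow> X * X = X' * X' \<and> Y * Y = Y' * Y'"
    if "X \<in> carrier_mat k k" "X' \<in> carrier_mat k k" "Y \<in> carrier_mat m m" "Y' \<in> carrier_mat m m" for X Y X' Y'
    using bdiag_inj that by simp
  show ?thesis
    unfolding strictly_compatible_def
    using c c' cc
    by (simp add: e bdiag_minus bdiag_mult s positive_bdiag_iff det_bdiag) blast
qed

lemma eigenvalue_nonzero:
  fixes A :: "complex mat"
  assumes "A \<in> carrier_mat n n" "det A \<noteq> 0" "v \<in> carrier_vec n" "v \<noteq> 0\<^sub>v n" "A *\<^sub>v v = c \<cdot>\<^sub>v v"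
  shows "c \<noteq> 0"
proof
  assume "c = 0"
  then have "A *\<^sub>v v = 0\<^sub>v n" using assms by auto
  then show False using det_0_iff_vec_prod_zero[OF assms(1)] assms(2-4) by blast
qed

text \<open>Factor P^2 - p^2 as (P + p)(P - p): the vector z = (P - p)v satisfies Pz = -pz. For p >
  0 this contradicts positivity unless z = 0.\<close>

lemma positive_sqrt_eigenvector:
  assumes P: "P \<in> carrier_mat n n" "positive_mat P" and v: "v \<in> carrier_vec n"
    and eq: "P *\<^sub>v (P *\<^sub>v v) = complex_of_real (p\<^sup>2) \<cdot>\<^sub>v v" and p: "p \<ge> 0"
  shows "P *\<^sub>v v = complex_of_real p \<cdot>\<^sub>v v"
proof -
  let ?p = "complex_of_real p"
  have h: "hermitian P" using P by (simp add: positive_mat_def)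
  have c: "P *\<^sub>v v \<in> carrier_vec n" using P v by simp
  define z where "z = P *\<^sub>v v - ?p \<cdot>\<^sub>v v"
  have z: "z \<in> carrier_vec n" using c v by (simp add: z_def)
  have Pz: "P *\<^sub>v z = (- ?p) \<cdot>\<^sub>v z"
  proof -
    have "P *\<^sub>v z = P *\<^sub>v (P *\<^sub>v v) - ?p \<cdot>\<^sub>v (P *\<^sub>v v)"
      unfolding z_def using P(1) v c
      by (simp add: mult_minus_distrib_mat_vec[of _ n n] mult_mat_vec[of _ n n])
    also have "\<dots> = (- ?p) \<cdot>\<^sub>v z"
      unfolding eq z_def using v c P(1)
      by (intro eq_vecI) (auto simp: right_diff_distrib power2_eq_square simp del: index_mult_mat_vec)
    finally show ?thesis .
  qed
  have "z \<bullet>c z = 0"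
  proof (cases "p = 0")
    \<comment> \<open>For p = 0 positivity gives nothing, but then z = Pv and Pz = 0, so (z, z) =
      (v, Pz) = 0.\<close>
    case True
    then have "z = P *\<^sub>v v"
      unfolding z_def using v P(1) by (intro eq_vecI) (auto simp del: index_mult_mat_vec)
    moreover have "P *\<^sub>v z = 0\<^sub>v n" unfolding Pz using True z by auto
    ultimately show ?thesis using hermitian_cscalar[OF h P(1) v z] v by simp
  next
    case False
    have "0 \<le> (P *\<^sub>v z) \<bullet>c z" using P z by (simp add: positive_mat_def)
    also have "(P *\<^sub>v z) \<bullet>c z = - ?p * (z \<bullet>c z)"
      unfolding Pz by (rule cscalar_prod_add(5)[OF z z z])
    finally have "0 \<le> - p * Re (z \<bullet>c z)" by (simp add: less_eq_complex_def)
    moreover have zz: "z \<bullet>c z = complex_of_real (\<Sum>i<dim_vec z. (cmod (z $ i))\<^sup>2)"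
      by (rule cscalar_prod_self)
    moreover have "0 \<le> Re (z \<bullet>c z)" unfolding zz by (simp add: sum_nonneg)
    ultimately have "Re (z \<bullet>c z) = 0"
      using p False by (simp add: mult_le_0_iff)
    then show ?thesis unfolding zz by (simp only: Re_complex_of_real of_real_0)
  qed
  then have z0: "z = 0\<^sub>v n" using cscalar_prod_self_eq_0[OF z] by simp
  show ?thesis using vec_minus_eq_0[OF c _ z0[unfolded z_def]] v by simp
qed

text \<open>Invariance under \<open>a\<close> and \<open>b\<close> is stated in the form that
  \<open>orthonormal_block\<close> expects. For \<open>P\<close> more is recorded, namely a common
  eigenvalue of \<open>e\<close> and \<open>f\<close>, which makes its block on the plane
  scalar.\<close>

lemma strictly_compatible_invariant_plane:
  assumes H: "strictly_compatible n a b P" and n: "n > 0"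
  obtains e f and p :: real where "orthonormal_list n [e, f]"
    "P *\<^sub>v e = complex_of_real p \<cdot>\<^sub>v e" "P *\<^sub>v f = complex_of_real p \<cdot>\<^sub>v f"
    "\<And>A u v. A \<in> {a, b} \<Longrightarrow> u \<in> {e, f} \<Longrightarrow> v \<in> carrier_vec n \<Longrightarrow> e \<bullet>c v = 0 \<Longrightarrow> f \<bullet>c v = 0 \<Longrightarrow>
      (A *\<^sub>v u) \<bullet>c v = 0"
proof -
  let ?I = "1\<^sub>m n :: complex mat"
  have c: "a \<in> carrier_mat n n" "b \<in> carrier_mat n n" "P \<in> carrier_mat n n"
    and h: "hermitian a" "hermitian b" "hermitian P"
    and P: "positive_mat P" "positive_mat (?I - P)"
    using H by (auto simp: strictly_compatible_def positive_mat_def)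
  define x where "x = a - b"
  define y where "y = ?I - a - b"
  have PP: "P * P = x * x" "(?I - P) * (?I - P) = y * y"
    using H by (auto simp: strictly_compatible_def x_def y_def)
  have IP: "?I - P \<in> carrier_mat n n" "?I - a \<in> carrier_mat n n" "?I - b \<in> carrier_mat n n"
    using c minus_carrier_mat by auto
  have x: "x \<in> carrier_mat n n" "hermitian x"
    using c h hermitian_minus by (auto simp: x_def)
  have y: "y \<in> carrier_mat n n" "hermitian y"
    using c h IP hermitian_minus[of ?I n a] hermitian_minus[of "?I - a" n b] hermitian_one
      minus_carrier_mat[OF c(2)] by (simp_all add: y_def)
  have xv: "x *\<^sub>v v = a *\<^sub>v v - b *\<^sub>v v" if "v \<in> carrier_vec n" for v
    using minus_mult_distrib_mat_vec c that by (simp add: x_def)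
  have yv: "y *\<^sub>v v = v - a *\<^sub>v v - b *\<^sub>v v" if "v \<in> carrier_vec n" for v
    using minus_mult_distrib_mat_vec[OF IP(2) c(2) that] minus_mult_distrib_mat_vec[of ?I n n a v] c that
    by (simp add: y_def)
  have Px: "P * x = x * P" by (rule positive_sqrt_commute[OF x c(3) P(1) PP(1)])
  have "(?I - P) * y = y * (?I - P)" by (rule positive_sqrt_commute[OF y IP(1) P(2) PP(2)])
  then have IPy: "y - P * y = y - y * P"
    using c y by (simp add: minus_mult_distrib_mat[of _ n n _ _ n] mult_minus_distrib_mat[of _ n n _ n])
  have Py: "P * y = y * P"
  proof (rule eq_matI)
    fix i j assume "i < dim_row (y * P)" "j < dim_col (y * P)"
    then show "(P * y) $$ (i,j) = (y * P) $$ (i,j)"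
      using arg_cong[OF IPy, of "\<lambda>M. M $$ (i,j)"] c y by (simp del: index_mult_mat(1))
  qed (use c y in auto)
  define K where "K = x * y + y * x"
  have cm: "x * y \<in> carrier_mat n n" "y * x \<in> carrier_mat n n" "x * x \<in> carrier_mat n n"
    "y * y \<in> carrier_mat n n"
    using x y by auto
  have K: "K \<in> carrier_mat n n" "hermitian K"
    using x y cm by (auto simp: K_def hermitian_iff[of _ n] mat_adjoint_add[of _ n n]
        mat_adjoint_mult[of _ n n _ n] comm_add_mat[of _ n n])
  \<comment> \<open>This is all that \<open>x * K = K * x\<close> needs: the term xyx occurs on both
    sides, and the remaining terms are x^2 y and y x^2.\<close>
  have x2y: "x * (x * y) = y * (x * x)"
  proof -
    have "x * (x * y) = P * (P * y)"
      using square_mult_assoc[OF x(1) x(1) y(1)] square_mult_assoc[OF c(3) c(3) y(1)] PP(1) by simp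
    also have "\<dots> = P * (y * P)" unfolding Py ..
    also have "\<dots> = y * P * P" using square_mult_assoc[OF c(3) y(1) c(3)] Py by simp
    also have "\<dots> = y * (x * x)" using square_mult_assoc[OF y(1) c(3) c(3)] PP(1) by simp
    finally show ?thesis .
  qed
  have "x * K = K * x"
  proof -
    have "x * K = x * (x * y) + x * (y * x)"
      unfolding K_def using x cm by (simp add: mult_add_distrib_mat[of _ n n _ n])
    also have "\<dots> = x * (y * x) + y * (x * x)"
      unfolding x2y using x y cm by (intro comm_add_mat[of _ n n]) (auto intro: square_mult_closed)
    also have "\<dots> = K * x"
      unfolding K_def using x y cm
      by (simp add: add_mult_distrib_mat[of _ n n _ _ n] square_mult_assoc[of _ n])
    finally show ?thesis .
  qed
  then obtain e and t k :: real where e: "e \<in> carrier_vec n" "e \<bullet>c e = 1"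
    and xe: "x *\<^sub>v e = complex_of_real t \<cdot>\<^sub>v e" and Ke: "K *\<^sub>v e = complex_of_real k \<cdot>\<^sub>v e"
    using commuting_hermitian_common_eigenvector[OF x K _ n] by blast
  have e0: "e \<noteq> 0\<^sub>v n" using e cscalar_prod_self_eq_0[OF e(1)] by auto
  \<comment> \<open>Since P^2 e = x^2 e = t^2 e and \<open>P\<close> is positive, its eigenvalue at
    \<open>e\<close> can only be |t|.\<close>
  define p where "p = \<bar>t\<bar>"
  let ?p = "complex_of_real p"
  have Pe: "P *\<^sub>v e = ?p \<cdot>\<^sub>v e"
  proof (rule positive_sqrt_eigenvector[OF c(3) P(1) e(1)])
    have "P *\<^sub>v (P *\<^sub>v e) = x *\<^sub>v (x *\<^sub>v e)"
      by (simp only: assoc_mult_mat_vec[OF c(3) c(3) e(1), symmetric]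
          assoc_mult_mat_vec[OF x(1) x(1) e(1), symmetric] PP)
    also have "\<dots> = complex_of_real (p\<^sup>2) \<cdot>\<^sub>v e"
      unfolding xe using x e by (simp add: mult_mat_vec[of _ n n] xe smult_smult_assoc p_def power2_eq_square)
    finally show "P *\<^sub>v (P *\<^sub>v e) = complex_of_real (p\<^sup>2) \<cdot>\<^sub>v e" .
  qed (simp add: p_def)
  define g where "g = y *\<^sub>v e"
  have g: "g \<in> carrier_vec n" using y e by (simp add: g_def)
  have Pg: "P *\<^sub>v g = ?p \<cdot>\<^sub>v g"
  proof -
    have "P *\<^sub>v g = y *\<^sub>v (P *\<^sub>v e)"
      unfolding g_def by (simp only: assoc_mult_mat_vec[OF c(3) y(1) e(1), symmetric] Py
          assoc_mult_mat_vec[OF y(1) c(3) e(1)])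
    then show ?thesis unfolding Pe g_def using y e by (simp add: mult_mat_vec[of _ n n])
  qed
  \<comment> \<open>Here y^2 = (1 - P)^2 brings ye back to a multiple of \<open>e\<close>.\<close>
  have yg: "y *\<^sub>v g = ((1 - ?p) * (1 - ?p)) \<cdot>\<^sub>v e"
  proof -
    have IPe: "(?I - P) *\<^sub>v e = (1 - ?p) \<cdot>\<^sub>v e"
      using minus_mult_distrib_mat_vec[of ?I n n P e] c e Pe by (intro eq_vecI) (auto simp: algebra_simps)
    have "y *\<^sub>v g = (?I - P) *\<^sub>v ((?I - P) *\<^sub>v e)"
      unfolding g_def by (simp only: assoc_mult_mat_vec[OF y(1) y(1) e(1), symmetric]
          assoc_mult_mat_vec[OF IP(1) IP(1) e(1), symmetric] PP)
    also have "\<dots> = ((1 - ?p) * (1 - ?p)) \<cdot>\<^sub>v e"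
      unfolding IPe using IP(1) e by (simp add: mult_mat_vec[of _ n n] IPe smult_smult_assoc)
    finally show ?thesis .
  qed
  \<comment> \<open>This is where the eigenvalue equation for \<open>K\<close> is used: solve Ke =
    x(ye) + y(xe) for x(ye).\<close>
  have xg: "x *\<^sub>v g = complex_of_real k \<cdot>\<^sub>v e - complex_of_real t \<cdot>\<^sub>v g"
  proof -
    have "K *\<^sub>v e = x *\<^sub>v g + y *\<^sub>v (x *\<^sub>v e)"
      unfolding K_def g_def using x y e cm
      by (simp add: add_mult_distrib_mat_vec[of _ n n] assoc_mult_mat_vec[of _ n n _ n])
    also have "y *\<^sub>v (x *\<^sub>v e) = complex_of_real t \<cdot>\<^sub>v g"
      unfolding xe g_def using y e by (simp add: mult_mat_vec[of _ n n])
    finally have eq: "complex_of_real k \<cdot>\<^sub>v e = x *\<^sub>v g + complex_of_real t \<cdot>\<^sub>v g" unfolding Ke .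
    show ?thesis unfolding eq using x g by (intro eq_vecI) auto
  qed
  have ev: "A *\<^sub>v e = d \<cdot>\<^sub>v e \<Longrightarrow> d \<noteq> 0 \<and> d \<noteq> 1" if "A \<in> {a, b}" for A d
  proof -
    assume Ae: "A *\<^sub>v e = d \<cdot>\<^sub>v e"
    have A: "A \<in> carrier_mat n n" "det A \<noteq> 0" "det (?I - A) \<noteq> 0"
      using that c H by (auto simp: strictly_compatible_def)
    have "(?I - A) *\<^sub>v e = (1 - d) \<cdot>\<^sub>v e"
      using minus_mult_distrib_mat_vec[of ?I n n A e] A e Ae by (intro eq_vecI) (auto simp: algebra_simps)
    then have "1 - d \<noteq> 0"
      using eigenvalue_nonzero[OF _ A(3) e(1) e0] A(1) minus_carrier_mat by blast
    then show ?thesis using eigenvalue_nonzero[OF A(1,2) e(1) e0 Ae] by simp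
  qed
  \<comment> \<open>One Gram-Schmidt step: \<open>z\<close> is the part of ye orthogonal to
    \<open>e\<close>, and it vanishes exactly when \<open>e\<close> and ye span only a line.\<close>
  define r where "r = g \<bullet>c e"
  define z where "z = g - r \<cdot>\<^sub>v e"
  have z: "z \<in> carrier_vec n" using g e by (simp add: z_def)
  \<comment> \<open>If z = 0, then ye = re with r = 1 - p or r = p - 1, while t = p or t = -p. The
    eigenvalues (1 + t - r)/2 of \<open>a\<close> and (1 - t - r)/2 of \<open>b\<close> at
    \<open>e\<close> then include 0 when r = 1 - p, and 1 when r = p - 1. Either contradicts
    strictness.\<close>
  have "z \<noteq> 0\<^sub>v n"
  proof
    assume z0: "z = 0\<^sub>v n"
    have ge: "g = r \<cdot>\<^sub>v e"
      using vec_minus_eq_0[OF g _ z0[unfolded z_def]] e by simp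
    have ye: "y *\<^sub>v e = r \<cdot>\<^sub>v e" using ge by (simp add: g_def)
    have "(r * r) \<cdot>\<^sub>v e = y *\<^sub>v g"
      unfolding ge using y e by (simp add: mult_mat_vec[of _ n n] ye smult_smult_assoc)
    then have "r * r = (1 - ?p) * (1 - ?p)" unfolding yg using smult_eq_imp_eq[OF e(1) e0] by blast
    then have r_cases: "r = 1 - ?p \<or> r = - (1 - ?p)" by (simp add: square_eq_iff)
    have comp: "(a *\<^sub>v e) $ j - (b *\<^sub>v e) $ j = t * e $ j"
      "e $ j - (a *\<^sub>v e) $ j - (b *\<^sub>v e) $ j = r * e $ j" if "j < n" for j
      using arg_cong[OF xe, of "\<lambda>v. v $ j"] arg_cong[OF ye, of "\<lambda>v. v $ j"] xv[OF e(1)] yv[OF e(1)] that e c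
      by (simp_all del: index_mult_mat_vec)
    have ae: "a *\<^sub>v e = ((1 + t - r) / 2) \<cdot>\<^sub>v e"
    proof (rule eq_vecI)
      fix j assume "j < dim_vec (((1 + t - r) / 2) \<cdot>\<^sub>v e)"
      then have j: "j < n" using e by simp
      have "2 * (a *\<^sub>v e) $ j = (1 + t - r) * e $ j" using comp[OF j] by (simp add: algebra_simps)
      then show "(a *\<^sub>v e) $ j = (((1 + t - r) / 2) \<cdot>\<^sub>v e) $ j" using j e by (simp add: mult.commute del: index_mult_mat_vec)
    qed (use c e in auto)
    have be: "b *\<^sub>v e = ((1 - t - r) / 2) \<cdot>\<^sub>v e"
    proof (rule eq_vecI)
      fix j assume "j < dim_vec (((1 - t - r) / 2) \<cdot>\<^sub>v e)"
      then have j: "j < n" using e by simp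
      have "2 * (b *\<^sub>v e) $ j = (1 - t - r) * e $ j" using comp[OF j] by (simp add: algebra_simps)
      then show "(b *\<^sub>v e) $ j = (((1 - t - r) / 2) \<cdot>\<^sub>v e) $ j" using j e by (simp add: mult.commute del: index_mult_mat_vec)
    qed (use c e in auto)
    have "?p = t \<or> ?p = - complex_of_real t" by (auto simp: p_def abs_if)
    then show False using ev[OF _ ae] ev[OF _ be] r_cases by auto
  qed
  from vec_normalize[OF z this] obtain d where d: "d \<noteq> 0" "(d \<cdot>\<^sub>v z) \<bullet>c (d \<cdot>\<^sub>v z) = 1" by blast
  define f where "f = d \<cdot>\<^sub>v z"
  have f: "f \<in> carrier_vec n" using z by (simp add: f_def)
  have re: "r \<cdot>\<^sub>v e \<in> carrier_vec n" using e by simp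
  have "z \<bullet>c e = 0"
    unfolding z_def using cscalar_prod_add(3)[OF g re e(1)] cscalar_prod_add(5)[OF e(1) e(1) e(1)] e(2)
    by (simp add: r_def)
  then have fe: "f \<bullet>c e = 0" unfolding f_def using cscalar_prod_add(5)[OF z z e(1)] by simp
  then have ef: "e \<bullet>c f = 0" using cscalar_prod_cnj[OF f e(1)] by simp
  have on: "orthonormal_list n [e, f]"
    using e f fe ef d(2) by (auto simp: orthonormal_list_def f_def less_Suc_eq)
  have Pf: "P *\<^sub>v f = ?p \<cdot>\<^sub>v f"
  proof -
    have "P *\<^sub>v z = P *\<^sub>v g - r \<cdot>\<^sub>v (P *\<^sub>v e)"
      unfolding z_def using c g e re by (simp add: mult_minus_distrib_mat_vec[of _ n n] mult_mat_vec[of _ n n])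
    also have "\<dots> = ?p \<cdot>\<^sub>v z"
      unfolding Pg Pe z_def using g e by (intro eq_vecI) (auto simp: algebra_simps)
    finally have "P *\<^sub>v z = ?p \<cdot>\<^sub>v z" .
    then show ?thesis unfolding f_def using c z
      by (simp add: mult_mat_vec[of _ n n] smult_smult_assoc mult.commute)
  qed
  have inv: "(A *\<^sub>v u) \<bullet>c v = 0"
    if A: "A \<in> {a, b}" and u: "u \<in> {e, f}" and v: "v \<in> carrier_vec n" "e \<bullet>c v = 0" "f \<bullet>c v = 0" for A u v
  proof -
    have zv: "z \<bullet>c v = 0" using v(3) d(1) cscalar_prod_add(5)[OF z z v(1)] by (simp add: f_def)
    have gv: "g \<bullet>c v = 0"
      using zv cscalar_prod_add(3)[OF g re v(1)] cscalar_prod_add(5)[OF e(1) e(1) v(1)] v(2)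
      by (simp add: z_def)
    \<comment> \<open>Because a = (1 + x - y)/2 and b = (1 - x - y)/2, orthogonality to
      \<open>v\<close> has to be tested only on w, xw and yw.\<close>
    have red: "(a *\<^sub>v w) \<bullet>c v = 0 \<and> (b *\<^sub>v w) \<bullet>c v = 0"
      if w: "w \<in> carrier_vec n" "w \<bullet>c v = 0" "(x *\<^sub>v w) \<bullet>c v = 0" "(y *\<^sub>v w) \<bullet>c v = 0" for w
    proof -
      have cw: "a *\<^sub>v w \<in> carrier_vec n" "b *\<^sub>v w \<in> carrier_vec n" "w - a *\<^sub>v w \<in> carrier_vec n"
        using c w by auto
      have 1: "(a *\<^sub>v w) \<bullet>c v - (b *\<^sub>v w) \<bullet>c v = 0"
        using w(3) unfolding xv[OF w(1)] cscalar_prod_add(3)[OF cw(1,2) v(1)] .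
      have "0 - (a *\<^sub>v w) \<bullet>c v - (b *\<^sub>v w) \<bullet>c v = 0"
        using w(4) unfolding yv[OF w(1)] cscalar_prod_add(3)[OF cw(3,2) v(1)]
          cscalar_prod_add(3)[OF w(1) cw(1) v(1)] w(2) .
      with 1 show ?thesis by (auto simp: eq_neg_iff_add_eq_0 add_eq_0_iff)
    qed
    have re: "(a *\<^sub>v e) \<bullet>c v = 0 \<and> (b *\<^sub>v e) \<bullet>c v = 0"
      using red[OF e(1) v(2)] xe gv v(2) cscalar_prod_add(5)[OF e(1) e(1) v(1)] by (simp add: g_def)
    have "(x *\<^sub>v g) \<bullet>c v = 0"
      unfolding xg using cscalar_prod_add(3)[of "complex_of_real k \<cdot>\<^sub>v e" n "complex_of_real t \<cdot>\<^sub>v g" v]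
        cscalar_prod_add(5)[OF e(1) e(1) v(1)] cscalar_prod_add(5)[OF g g v(1)] v gv e g by simp
    moreover have "(y *\<^sub>v g) \<bullet>c v = 0"
      unfolding yg using cscalar_prod_add(5)[OF e(1) e(1) v(1)] v by simp
    ultimately have rg: "(a *\<^sub>v g) \<bullet>c v = 0 \<and> (b *\<^sub>v g) \<bullet>c v = 0" using red[OF g gv] by blast
    have "(A *\<^sub>v f) \<bullet>c v = 0"
    proof -
      have Ac: "A \<in> carrier_mat n n" using A c by auto
      then have cc: "A *\<^sub>v g \<in> carrier_vec n" "A *\<^sub>v e \<in> carrier_vec n" "A *\<^sub>v z \<in> carrier_vec n"
        "r \<cdot>\<^sub>v (A *\<^sub>v e) \<in> carrier_vec n" using g e z by auto
      have "A *\<^sub>v z = A *\<^sub>v g - r \<cdot>\<^sub>v (A *\<^sub>v e)"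
        unfolding z_def using Ac g e by (simp add: mult_minus_distrib_mat_vec[of _ n n] mult_mat_vec[of _ n n])
      then have "(A *\<^sub>v z) \<bullet>c v = 0"
        using cscalar_prod_add(3)[OF cc(1,4) v(1)] cscalar_prod_add(5)[OF cc(2,2) v(1)] re rg A by auto
      moreover have "A *\<^sub>v f = d \<cdot>\<^sub>v (A *\<^sub>v z)" unfolding f_def using Ac z by (simp add: mult_mat_vec[of _ n n])
      ultimately show ?thesis using cscalar_prod_add(5)[OF cc(3,3) v(1)] by simp
    qed
    then show ?thesis using u A re by auto
  qed
  show ?thesis by (rule that[OF on Pe Pf inv])
qed

section \<open>The two-dimensional blocks\<close>

lemma index_mult_mat_2:
  assumes "A \<in> carrier_mat 2 2" "B \<in> carrier_mat 2 2" "i < 2" "j < 2"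
  shows "(A * B) $$ (i,j) = A $$ (i,0) * B $$ (0,j) + A $$ (i,1) * B $$ (1,j)"
  using assms by (simp add: scalar_prod_def numeral_2_eq_2)

lemma det_2_2:
  fixes A :: "complex mat"
  assumes "A \<in> carrier_mat 2 2"
  shows "det A = A $$ (0,0) * A $$ (1,1) - A $$ (0,1) * A $$ (1,0)"
proof -
  have "det (mat_delete A 0 j) = mat_delete A 0 j $$ (0,0)" if "j < 2" for j
    using mat_delete_carrier[OF assms, of 0 j] by (intro det_single) auto
  then show ?thesis
    using laplace_expansion_row[OF assms, of 0] assms
    by (simp add: cofactor_def mat_delete_def numeral_2_eq_2)
qed

lemma hermitian_2_2:
  assumes "X \<in> carrier_mat 2 2" "hermitian X"
  shows "X $$ (0,0) = complex_of_real (Re (X $$ (0,0)))" "X $$ (1,1) = complex_of_real (Re (X $$ (1,1)))"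
    "X $$ (1,0) = cnj (X $$ (0,1))"
proof -
  have "X $$ (i,j) = cnj (X $$ (j,i))" if "i < 2" "j < 2" for i j
    using assms that mat_adjoint_index[of i X j] by (simp add: hermitian_def)
  from this[of 0 0] this[of 1 1] this[of 1 0]
  show "X $$ (0,0) = complex_of_real (Re (X $$ (0,0)))" "X $$ (1,1) = complex_of_real (Re (X $$ (1,1)))"
    "X $$ (1,0) = cnj (X $$ (0,1))"
    by (simp_all add: complex_eq_iff)
qed

text \<open>The off-diagonal entry of X^2 is that of X times the trace. So a nonzero trace makes X
  diagonal, and the equal squares of its diagonal entries then make it scalar. Real coordinates turn
  this dichotomy into real polynomial equations.\<close>

lemma hermitian_2_2_square:
  assumes X: "X \<in> carrier_mat 2 2" "hermitian X" and sq: "X * X = complex_of_real q \<cdot>\<^sub>m 1\<^sub>m 2"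
  defines "x1 \<equiv> Re (X $$ (0,0))" and "x2 \<equiv> Re (X $$ (1,1))"
    and "u1 \<equiv> Re (X $$ (0,1))" and "u2 \<equiv> Im (X $$ (0,1))"
  shows "x1\<^sup>2 + u1\<^sup>2 + u2\<^sup>2 = q" "x2\<^sup>2 + u1\<^sup>2 + u2\<^sup>2 = q" "u1 * (x1 + x2) = 0" "u2 * (x1 + x2) = 0"
proof -
  have e: "X $$ (0,0) = complex_of_real x1" "X $$ (1,1) = complex_of_real x2"
    "X $$ (0,1) = Complex u1 u2" "X $$ (1,0) = Complex u1 (- u2)"
    using hermitian_2_2[OF X] by (simp_all add: x1_def x2_def u1_def u2_def complex_eq_iff)
  have q: "X $$ (i,0) * X $$ (0,j) + X $$ (i,1) * X $$ (1,j) = (if i = j then complex_of_real q else 0)"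
    if "i < 2" "j < 2" for i j
    using arg_cong[OF sq, of "\<lambda>M. M $$ (i,j)"] index_mult_mat_2[OF X(1) X(1) that] that
    by (simp del: index_mult_mat(1))
  show "x1\<^sup>2 + u1\<^sup>2 + u2\<^sup>2 = q" "x2\<^sup>2 + u1\<^sup>2 + u2\<^sup>2 = q" "u1 * (x1 + x2) = 0" "u2 * (x1 + x2) = 0"
    using q[of 0 0] q[of 1 1] q[of 0 1] unfolding e
    by (simp_all add: complex_eq_iff power2_eq_square algebra_simps)
qed

text \<open>The quadratic form is tested on the two columns of the adjugate, which \<open>X\<close>
  sends to multiples of the unit vectors by \<open>det X\<close>; the values are the diagonal
  entries times \<open>det X\<close>. Once the trace is known to be 1, the conclusion is that the
  determinant is nonnegative.\<close>

lemma positive_2_2_det: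
  assumes X: "X \<in> carrier_mat 2 2" "positive_mat X"
  shows "0 \<le> Re (X $$ (0,0) + X $$ (1,1)) * Re (det X)"
proof -
  have h: "hermitian X" using X by (simp add: positive_mat_def)
  note e = hermitian_2_2[OF X(1) h]
  have cnj: "cnj (X $$ (0,0)) = X $$ (0,0)" "cnj (X $$ (1,1)) = X $$ (1,1)"
    by (metis e(1) complex_cnj_complex_of_real, metis e(2) complex_cnj_complex_of_real)
  have form: "(X *\<^sub>v v) \<bullet>c v = (X $$ (0,0) * v $ 0 + X $$ (0,1) * v $ 1) * cnj (v $ 0)
      + (X $$ (1,0) * v $ 0 + X $$ (1,1) * v $ 1) * cnj (v $ 1)" if "v \<in> carrier_vec 2" for v
    using X(1) that by (simp add: cscalar_prod_sum[of _ 2] scalar_prod_def numeral_2_eq_2)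
  have pos: "0 \<le> Re ((X *\<^sub>v v) \<bullet>c v)" if "v \<in> carrier_vec 2" for v
    using X that by (simp add: positive_mat_def less_eq_complex_def)
  define v where "v = vec 2 (\<lambda>i. if i = 0 then - X $$ (0,1) else X $$ (0,0))"
  define w where "w = vec 2 (\<lambda>i. if i = 0 then X $$ (1,1) else - X $$ (1,0))"
  have vw: "v \<in> carrier_vec 2" "w \<in> carrier_vec 2" by (simp_all add: v_def w_def)
  have "(X *\<^sub>v v) \<bullet>c v = X $$ (0,0) * det X"
    unfolding form[OF vw(1)] det_2_2[OF X(1)] using cnj
    by (simp add: v_def algebra_simps)
  moreover have "(X *\<^sub>v w) \<bullet>c w = X $$ (1,1) * det X"
    unfolding form[OF vw(2)] det_2_2[OF X(1)] using cnj
    by (simp add: w_def algebra_simps)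
  ultimately have "0 \<le> Re (X $$ (0,0) * det X) + Re (X $$ (1,1) * det X)"
    using pos[OF vw(1)] pos[OF vw(2)] by simp
  also have "\<dots> = Re (X $$ (0,0) + X $$ (1,1)) * Re (det X)"
    by (subst (1 2) e(1), subst (1 2) e(2)) (simp add: algebra_simps)
  finally show ?thesis .
qed

text \<open>The entries are those of \<open>a = (a1, z; z*, a2)\<close> and \<open>b = (b1, w; w*, b2)\<close>. A hermitian \<open>2 \<times> 2\<close> matrix with scalar square is scalar or traceless.
  If \<open>a - b\<close> or \<open>1 - a - b\<close> is scalar, then one of the four determinants vanishes.\<close>

lemma compatible_2_2_entries:
  fixes a1 a2 b1 b2 z1 z2 w1 w2 p :: real
  assumes X: "(a1 - b1)\<^sup>2 + (z1 - w1)\<^sup>2 + (z2 - w2)\<^sup>2 = p\<^sup>2" "(a2 - b2)\<^sup>2 + (z1 - w1)\<^sup>2 + (z2 - w2)\<^sup>2 = p\<^sup>2"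
    "(z1 - w1) * (a1 - b1 + (a2 - b2)) = 0" "(z2 - w2) * (a1 - b1 + (a2 - b2)) = 0"
    and Y: "(1 - a1 - b1)\<^sup>2 + (z1 + w1)\<^sup>2 + (z2 + w2)\<^sup>2 = (1 - p)\<^sup>2"
    "(1 - a2 - b2)\<^sup>2 + (z1 + w1)\<^sup>2 + (z2 + w2)\<^sup>2 = (1 - p)\<^sup>2"
    "(z1 + w1) * (1 - a1 - b1 + (1 - a2 - b2)) = 0" "(z2 + w2) * (1 - a1 - b1 + (1 - a2 - b2)) = 0"
    and da: "a1 * a2 - (z1\<^sup>2 + z2\<^sup>2) \<noteq> 0" "(1 - a1) * (1 - a2) - (z1\<^sup>2 + z2\<^sup>2) \<noteq> 0"
    and db: "b1 * b2 - (w1\<^sup>2 + w2\<^sup>2) \<noteq> 0" "(1 - b1) * (1 - b2) - (w1\<^sup>2 + w2\<^sup>2) \<noteq> 0"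
  shows "a1 + a2 = 1" "b1 + b2 = 1" "a1 * a2 - (z1\<^sup>2 + z2\<^sup>2) < 1/4" "b1 * b2 - (w1\<^sup>2 + w2\<^sup>2) < 1/4"
proof -
  have trX: "a1 - b1 + (a2 - b2) = 0"
  proof (rule ccontr)
    assume s: "a1 - b1 + (a2 - b2) \<noteq> 0"
    then have zw: "z1 = w1" "z2 = w2" using X by auto
    have "(a1 - b1)\<^sup>2 = (a2 - b2)\<^sup>2" using X(1,2) by simp
    then have d: "a1 - b1 = a2 - b2" using s by (auto simp: power2_eq_iff)
    have "(a1 - b1)\<^sup>2 = p\<^sup>2" using X(1) zw by simp
    then have dp: "a1 - b1 = p \<or> a1 - b1 = - p" by (simp add: power2_eq_iff)
    show False
    proof (cases "1 - a1 - b1 + (1 - a2 - b2) = 0")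
      case True
      \<comment> \<open>Put d = a1 - b1, so that a - b is the scalar d and y = 1 - a - b is
        traceless with square (1 - p)^2. From a = (1 + d - y)/2 and b = (1 - d - y)/2 one gets 4 det
        a = (1 + d)^2 - (1 - p)^2 and 4 det b = (1 - d)^2 - (1 - p)^2. The first vanishes if d = -p,
        the second if d = p.\<close>
      have a2: "a2 = 1 + (a1 - b1) - a1" and b2: "b2 = 1 - (a1 - b1) - b1"
        using True d by simp_all
      have "4 * (a1 * a2 - (z1\<^sup>2 + z2\<^sup>2)) = (1 + (a1 - b1))\<^sup>2 - (1 - p)\<^sup>2"
        unfolding Y(1)[symmetric] a2 zw by (simp add: power2_eq_square algebra_simps)
      moreover have "4 * (b1 * b2 - (w1\<^sup>2 + w2\<^sup>2)) = (1 - (a1 - b1))\<^sup>2 - (1 - p)\<^sup>2"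
        unfolding Y(1)[symmetric] b2 zw by (simp add: power2_eq_square algebra_simps)
      ultimately show False using dp da(1) db(1) by auto
    next
      case False
      \<comment> \<open>Now \<open>a\<close> and \<open>b\<close> are both scalar, and the sign
        cases are those that ruled out an invariant line: one of the two scalars is 0 or 1.\<close>
      then have "z1 = - w1" "z2 = - w2" using Y by auto
      then have z0: "z1 = 0" "z2 = 0" "w1 = 0" "w2 = 0" using zw by auto
      have "(1 - a1 - b1)\<^sup>2 = (1 - a2 - b2)\<^sup>2" using Y(1,2) by simp
      then have e: "1 - a1 - b1 = 1 - a2 - b2" using False by (auto simp: power2_eq_iff)
      have "(1 - a1 - b1)\<^sup>2 = (1 - p)\<^sup>2" using Y(1) z0 by simp
      then have ep: "1 - a1 - b1 = 1 - p \<or> 1 - a1 - b1 = - (1 - p)" by (simp only: power2_eq_iff)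
      have "a2 = a1" "b2 = b1" using d e by auto
      then have "a1 \<noteq> 0" "a1 \<noteq> 1" "b1 \<noteq> 0" "b1 \<noteq> 1" using da db z0 by auto
      then show False using dp ep by auto
    qed
  qed
  have trY: "1 - a1 - b1 + (1 - a2 - b2) = 0"
  proof (rule ccontr)
    assume s: "1 - a1 - b1 + (1 - a2 - b2) \<noteq> 0"
    then have zw: "z1 = - w1" "z2 = - w2" using Y by auto
    have "(1 - a1 - b1)\<^sup>2 = (1 - a2 - b2)\<^sup>2" using Y(1,2) by simp
    then have e: "1 - a1 - b1 = 1 - a2 - b2" using s by (auto simp: power2_eq_iff)
    have "(1 - a1 - b1)\<^sup>2 = (1 - p)\<^sup>2" using Y(1) zw by simp
    then have ep: "1 - a1 - b1 = 1 - p \<or> 1 - a1 - b1 = - (1 - p)" by (simp only: power2_eq_iff)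
    have b: "b1 = a2" "b2 = a1" using trX e by simp_all
    \<comment> \<open>Here y = 1 - (a1 + b1) is scalar and a - b is traceless with square p^2. The
      two signs of y = 1 - p or y = p - 1 make the determinant of \<open>a\<close> or of 1 - a
      vanish, respectively.\<close>
    have "4 * (a1 * a2 - (z1\<^sup>2 + z2\<^sup>2)) = (a1 + b1)\<^sup>2 - p\<^sup>2"
      unfolding X(1)[symmetric] b zw by (simp add: power2_eq_square algebra_simps)
    moreover have "4 * ((1 - a1) * (1 - a2) - (z1\<^sup>2 + z2\<^sup>2)) = (2 - (a1 + b1))\<^sup>2 - p\<^sup>2"
      unfolding X(1)[symmetric] b zw by (simp add: power2_eq_square algebra_simps)
    moreover have "a1 + b1 = p \<or> 2 - (a1 + b1) = p" using ep by auto
    ultimately show False using da by auto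
  qed
  show tr: "a1 + a2 = 1" "b1 + b2 = 1" using trX trY by auto
  \<comment> \<open>At trace 1 the gap 1/4 - det is the sum of squares (c - 1/2)^2 + u^2 + v^2, so
    it closes only at half the identity.\<close>
  have det_lt: "c * d - (u\<^sup>2 + v\<^sup>2) < 1/4" if "c + d = 1" "\<not> (c = 1/2 \<and> u = 0 \<and> v = 0)" for c d u v :: real
  proof -
    have "0 < (c - 1/2)\<^sup>2 + u\<^sup>2 + v\<^sup>2"
      using that(2) by (auto simp: add_pos_nonneg add_nonneg_pos)
    moreover have d: "d = 1 - c" using that by simp
    ultimately show ?thesis unfolding d by (simp add: power2_eq_square algebra_simps)
  qed
  show "a1 * a2 - (z1\<^sup>2 + z2\<^sup>2) < 1/4"
  proof (rule det_lt[OF tr(1)], rule notI)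
    \<comment> \<open>If \<open>a\<close> is half the identity, then a - b and 1 - a - b coincide.
      Hence p^2 = (1 - p)^2, so p = 1/2, and the determinant of \<open>b\<close> is 1/4 - p^2 =
      0.\<close>
    assume h: "a1 = 1/2 \<and> z1 = 0 \<and> z2 = 0"
    have b2: "b2 = 1 - b1" using tr by simp
    have e: "(1/2 - b1)\<^sup>2 + w1\<^sup>2 + w2\<^sup>2 = p\<^sup>2" "(1/2 - b1)\<^sup>2 + w1\<^sup>2 + w2\<^sup>2 = (1 - p)\<^sup>2"
      using X(1) Y(1) h by auto
    then have "p\<^sup>2 = (1 - p)\<^sup>2" by simp
    then have p: "p = 1/2" by (auto simp: power2_eq_iff)
    have "b1 * b2 - (w1\<^sup>2 + w2\<^sup>2) = 0"
      using e(1) unfolding p b2 by (simp add: power2_eq_square algebra_simps)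
    then show False using db by simp
  qed
  show "b1 * b2 - (w1\<^sup>2 + w2\<^sup>2) < 1/4"
  proof (rule det_lt[OF tr(2)], rule notI)
    \<comment> \<open>The mirror case: now a - b and 1 - a - b are negatives of each other, with the
      same effect on p, and the determinant of \<open>a\<close> vanishes.\<close>
    assume h: "b1 = 1/2 \<and> w1 = 0 \<and> w2 = 0"
    have a2: "a2 = 1 - a1" using tr by simp
    have e: "(a1 - 1/2)\<^sup>2 + z1\<^sup>2 + z2\<^sup>2 = p\<^sup>2" "(1/2 - a1)\<^sup>2 + z1\<^sup>2 + z2\<^sup>2 = (1 - p)\<^sup>2"
      using X(1) Y(1) h by (auto simp: algebra_simps)
    have "(a1 - 1/2)\<^sup>2 = (1/2 - a1)\<^sup>2" by (rule power2_commute)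
    then have "p\<^sup>2 = (1 - p)\<^sup>2" using e by simp
    then have p: "p = 1/2" by (auto simp: power2_eq_iff)
    have "a1 * a2 - (z1\<^sup>2 + z2\<^sup>2) = 0"
      using e(1) unfolding p a2 by (simp add: power2_eq_square algebra_simps)
    then show False using da by simp
  qed
qed

lemma strictly_compatible_2_2:
  assumes H: "strictly_compatible 2 a b (complex_of_real p \<cdot>\<^sub>m 1\<^sub>m 2)"
  shows "a \<in> S_set" "b \<in> S_set" "abs_compatible a b"
proof -
  let ?I = "1\<^sub>m 2 :: complex mat" and ?P = "complex_of_real p \<cdot>\<^sub>m 1\<^sub>m 2"
  have c: "a \<in> carrier_mat 2 2" "b \<in> carrier_mat 2 2" "?P \<in> carrier_mat 2 2"
    and pos: "positive_mat a" "positive_mat (?I - a)" "positive_mat b" "positive_mat (?I - b)"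
    and h: "hermitian a" "hermitian b" 
    and sq: "?P * ?P = (a - b) * (a - b)" "(?I - ?P) * (?I - ?P) = (?I - a - b) * (?I - a - b)"
    and det: "det a \<noteq> 0" "det (?I - a) \<noteq> 0" "det b \<noteq> 0" "det (?I - b) \<noteq> 0"
    using H by (auto simp: strictly_compatible_def positive_mat_def)
  show "abs_compatible a b"
    using H unfolding abs_compatible_iff[OF c(1) h(1) c(2) h(2)] strictly_compatible_def by blast
  have ic: "?I - a \<in> carrier_mat 2 2" "?I - b \<in> carrier_mat 2 2" "a - b \<in> carrier_mat 2 2"
    "?I - a - b \<in> carrier_mat 2 2" using c minus_carrier_mat by auto
  have hX: "hermitian (a - b)" using hermitian_minus[OF c(1,2) h] .
  have hY: "hermitian (?I - a - b)"
    using hermitian_minus[OF ic(1) c(2) hermitian_minus[OF _ c(1) hermitian_one h(1)] h(2)] by simp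
  have PP: "?P * ?P = complex_of_real (p\<^sup>2) \<cdot>\<^sub>m 1\<^sub>m 2"
    by (intro eq_matI) (auto simp: index_mult_mat_2 power2_eq_square less_2_cases_iff simp del: index_mult_mat(1))
  have IP: "?I - ?P = complex_of_real (1 - p) \<cdot>\<^sub>m 1\<^sub>m 2"
    by (intro eq_matI) auto
  have IPIP: "(?I - ?P) * (?I - ?P) = complex_of_real ((1 - p)\<^sup>2) \<cdot>\<^sub>m 1\<^sub>m 2"
    unfolding IP
    by (intro eq_matI) (auto simp: index_mult_mat_2 power2_eq_square less_2_cases_iff simp del: index_mult_mat(1))
  define a1 a2 z1 z2 where "a1 = Re (a $$ (0,0))" and "a2 = Re (a $$ (1,1))"
    and "z1 = Re (a $$ (0,1))" and "z2 = Im (a $$ (0,1))"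
  define b1 b2 w1 w2 where "b1 = Re (b $$ (0,0))" and "b2 = Re (b $$ (1,1))"
    and "w1 = Re (b $$ (0,1))" and "w2 = Im (b $$ (0,1))"
  note defs = a1_def a2_def z1_def z2_def b1_def b2_def w1_def w2_def
  have ea: "a $$ (0,0) = complex_of_real a1" "a $$ (1,1) = complex_of_real a2"
    "a $$ (0,1) = Complex z1 z2" "a $$ (1,0) = Complex z1 (- z2)"
    using hermitian_2_2[OF c(1) h(1)] by (simp_all add: defs complex_eq_iff)
  have eb: "b $$ (0,0) = complex_of_real b1" "b $$ (1,1) = complex_of_real b2"
    "b $$ (0,1) = Complex w1 w2" "b $$ (1,0) = Complex w1 (- w2)"
    using hermitian_2_2[OF c(2) h(2)] by (simp_all add: defs complex_eq_iff)
  have deta: "det a = complex_of_real (a1 * a2 - (z1\<^sup>2 + z2\<^sup>2))"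
    "det (?I - a) = complex_of_real ((1 - a1) * (1 - a2) - (z1\<^sup>2 + z2\<^sup>2))"
    using c(1) by (simp_all add: det_2_2[OF c(1)] det_2_2[OF ic(1)] ea[unfolded One_nat_def] complex_eq_iff power2_eq_square)
  have detb: "det b = complex_of_real (b1 * b2 - (w1\<^sup>2 + w2\<^sup>2))"
    "det (?I - b) = complex_of_real ((1 - b1) * (1 - b2) - (w1\<^sup>2 + w2\<^sup>2))"
    using c(2) by (simp_all add: det_2_2[OF c(2)] det_2_2[OF ic(2)] eb[unfolded One_nat_def] complex_eq_iff power2_eq_square)
  have eX: "Re ((a - b) $$ (0,0)) = a1 - b1" "Re ((a - b) $$ (1,1)) = a2 - b2"
    "Re ((a - b) $$ (0,1)) = z1 - w1" "Im ((a - b) $$ (0,1)) = z2 - w2"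
    using c by (simp_all add: defs)
  have eY: "Re ((?I - a - b) $$ (0,0)) = 1 - a1 - b1" "Re ((?I - a - b) $$ (1,1)) = 1 - a2 - b2"
    "Re ((?I - a - b) $$ (0,1)) = - (z1 + w1)" "Im ((?I - a - b) $$ (0,1)) = - (z2 + w2)"
    using c by (simp_all add: defs)
  note X = hermitian_2_2_square[OF ic(3) hX sq(1)[symmetric, unfolded PP], unfolded eX]
  note Y = hermitian_2_2_square[OF ic(4) hY sq(2)[symmetric, unfolded IPIP], unfolded eY]
  have nz: "a1 * a2 - (z1\<^sup>2 + z2\<^sup>2) \<noteq> 0" "(1 - a1) * (1 - a2) - (z1\<^sup>2 + z2\<^sup>2) \<noteq> 0"
    "b1 * b2 - (w1\<^sup>2 + w2\<^sup>2) \<noteq> 0" "(1 - b1) * (1 - b2) - (w1\<^sup>2 + w2\<^sup>2) \<noteq> 0"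
    using det unfolding deta detb by (simp_all only: of_real_eq_0_iff not_False_eq_True)
  have Y': "(1 - a1 - b1)\<^sup>2 + (z1 + w1)\<^sup>2 + (z2 + w2)\<^sup>2 = (1 - p)\<^sup>2"
    "(1 - a2 - b2)\<^sup>2 + (z1 + w1)\<^sup>2 + (z2 + w2)\<^sup>2 = (1 - p)\<^sup>2"
    "(z1 + w1) * (1 - a1 - b1 + (1 - a2 - b2)) = 0" "(z2 + w2) * (1 - a1 - b1 + (1 - a2 - b2)) = 0"
    using Y by (simp_all only: power2_minus mult_minus_left neg_equal_0_iff_equal)
  note R = compatible_2_2_entries[OF X Y' nz]
  \<comment> \<open>The trace is now known to be 1, so positivity gives a nonnegative determinant,
    and strictness makes it nonzero.\<close>
  have da: "0 < a1 * a2 - (z1\<^sup>2 + z2\<^sup>2)"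
    using positive_2_2_det[OF c(1) pos(1)] R(1) nz(1) unfolding deta ea by simp
  have db: "0 < b1 * b2 - (w1\<^sup>2 + w2\<^sup>2)"
    using positive_2_2_det[OF c(2) pos(3)] R(2) nz(3) unfolding detb eb by simp
  have tr: "mat_trace a = 1" "mat_trace b = 1"
    using c R(1,2) by (simp_all add: mat_trace_def numeral_2_eq_2 ea[unfolded One_nat_def]
        eb[unfolded One_nat_def] flip: of_real_add)
  have lt: "0 < complex_of_real s \<and> complex_of_real s < 1/4" if "0 < s" "s < 1/4" for s
    using that by (simp add: less_complex_def)
  have "0 < det a \<and> det a < 1/4" "0 < det b \<and> det b < 1/4"
    unfolding deta detb by (rule lt[OF da R(3)], rule lt[OF db R(4)])
  then show "a \<in> S_set" "b \<in> S_set"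
    unfolding S_set_def effect_def using c pos tr by auto
qed

section \<open>Splitting off planes by induction\<close>

text \<open>The induction is strong because each step lowers \<open>n\<close> by two, and
  \<open>P\<close> is generalised because the complement inherits its own certificate. The carrier
  facts about the block matrices belong to the claim since attaching the next block relies on
  them.\<close>

lemma strictly_compatible_decomposition:
  assumes "strictly_compatible n a b P"
  shows "even n \<and> (\<exists>as bs W. length as = n div 2 \<and> length bs = n div 2 \<and>
    set as \<subseteq> S_set \<and> set bs \<subseteq> S_set \<and> (\<forall>i < n div 2. abs_compatible (as ! i) (bs ! i)) \<and>
    diag_block_mat as \<in> carrier_mat n n \<and> diag_block_mat bs \<in> carrier_mat n n \<and>
    W \<in> carrier_mat n n \<and> unitary_mat W \<and>
    a = uconj W (diag_block_mat as) \<and> b = uconj W (diag_block_mat bs))"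
  using assms
proof (induction n arbitrary: a b P rule: less_induct)
  case (less n)
  have c: "a \<in> carrier_mat n n" "b \<in> carrier_mat n n" "P \<in> carrier_mat n n"
    and h: "hermitian a" "hermitian b" "hermitian P"
    using less.prems by (auto simp: strictly_compatible_def positive_mat_def)
  show ?case
  proof (cases "n = 0")
    case True
    then show ?thesis using c
      by (intro conjI exI[of _ "[]"] exI[of _ "1\<^sub>m 0"])
        (auto intro!: unitary_matI[of _ 0] simp: uconj_def)
  next
    case False
    then have "n > 0" by simp
    from strictly_compatible_invariant_plane[OF less.prems this]
    obtain e f and p :: real where on: "orthonormal_list n [e, f]"
      and Pe: "P *\<^sub>v e = complex_of_real p \<cdot>\<^sub>v e" "P *\<^sub>v f = complex_of_real p \<cdot>\<^sub>v f"
      and inv: "\<And>A u v. A \<in> {a, b} \<Longrightarrow> u \<in> {e, f} \<Longrightarrow> v \<in> carrier_vec n \<Longrightarrow> e \<bullet>c v = 0 \<Longrightarrow> f \<bullet>c v = 0 \<Longrightarrow>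
      (A *\<^sub>v u) \<bullet>c v = 0" by blast
    have ef: "e \<in> carrier_vec n" "f \<in> carrier_vec n" "e \<bullet>c e = 1" "f \<bullet>c f = 1" "e \<bullet>c f = 0" "f \<bullet>c e = 0"
      using on by (auto simp: orthonormal_list_def All_less_Suc)
    \<comment> \<open>Two orthonormal vectors do not fit into dimension one. With
      \<open>n = 0\<close> treated separately, this is where evenness comes from.\<close>
    have "n \<noteq> 1"
    proof
      assume n: "n = 1"
      then have "e $ 0 * cnj (e $ 0) = 1" "f $ 0 * cnj (f $ 0) = 1" "e $ 0 * cnj (f $ 0) = 0"
        using ef cscalar_prod_sum[of _ 1] by auto
      then show False by auto
    qed
    with \<open>n > 0\<close> have "2 \<le> n" by simp
    then obtain m where n: "2 + m = n" by (auto dest: le_Suc_ex)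
    have len2: "length [e, f] = 2" by simp
    obtain W where W: "W \<in> carrier_mat n n" "unitary_mat W" and
      blk: "\<And>A. A \<in> carrier_mat n n \<Longrightarrow> hermitian A \<Longrightarrow>
      (\<And>j v. j < 2 \<Longrightarrow> v \<in> carrier_vec n \<Longrightarrow> (\<And>i. i < 2 \<Longrightarrow> [e,f] ! i \<bullet>c v = 0) \<Longrightarrow> (A *\<^sub>v [e,f] ! j) \<bullet>c v = 0) \<Longrightarrow>
      \<exists>C \<in> carrier_mat m m.
        A = uconj W (bdiag 2 m (mat 2 2 (\<lambda>(i,j). (A *\<^sub>v [e,f] ! j) \<bullet>c [e,f] ! i)) C)"
      using orthonormal_block[OF on len2 n] by metis
    have orth: "e \<bullet>c v = 0 \<and> f \<bullet>c v = 0" if "\<And>i. i < 2 \<Longrightarrow> [e,f] ! i \<bullet>c v = 0" for v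
      using that[of 0] that[of 1] by simp
    define a1 where "a1 = mat 2 2 (\<lambda>(i,j). (a *\<^sub>v [e,f] ! j) \<bullet>c [e,f] ! i)"
    define b1 where "b1 = mat 2 2 (\<lambda>(i,j). (b *\<^sub>v [e,f] ! j) \<bullet>c [e,f] ! i)"
    have AC: "\<exists>C \<in> carrier_mat m m. A = uconj W (bdiag 2 m (mat 2 2 (\<lambda>(i,j). (A *\<^sub>v [e,f] ! j) \<bullet>c [e,f] ! i)) C)"
      if A: "A \<in> {a, b}" for A
    proof (rule blk)
      fix j v assume "j < (2::nat)" "v \<in> carrier_vec n" "\<And>i. i < 2 \<Longrightarrow> [e,f] ! i \<bullet>c v = 0"
      then show "(A *\<^sub>v [e,f] ! j) \<bullet>c v = 0"
        using inv[OF A, of "[e,f] ! j" v] orth[of v] by (auto simp: less_2_cases_iff)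
    qed (use A c h in auto)
    obtain a2 where a2: "a2 \<in> carrier_mat m m" "a = uconj W (bdiag 2 m a1 a2)"
      using AC[of a] unfolding a1_def by auto
    obtain b2 where b2: "b2 \<in> carrier_mat m m" "b = uconj W (bdiag 2 m b1 b2)"
      using AC[of b] unfolding b1_def by auto
    have Pu: "(P *\<^sub>v [e,f] ! j) \<bullet>c v = complex_of_real p * ([e,f] ! j \<bullet>c v)"
      if "j < 2" "v \<in> carrier_vec n" for j v
      using that Pe ef cscalar_prod_add(5)[of _ n _ v] by (auto simp: less_2_cases_iff)
    \<comment> \<open>On the orthonormal pair \<open>P\<close> acts as the scalar \<open>p\<close>,
      the shape that the analysis of 2 by 2 blocks presupposes.\<close>
    have "mat 2 2 (\<lambda>(i,j). (P *\<^sub>v [e,f] ! j) \<bullet>c [e,f] ! i) = complex_of_real p \<cdot>\<^sub>m 1\<^sub>m 2"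
    proof (rule eq_matI)
      fix i j assume "i < dim_row (complex_of_real p \<cdot>\<^sub>m 1\<^sub>m 2)" "j < dim_col (complex_of_real p \<cdot>\<^sub>m 1\<^sub>m 2)"
      then have "i < 2" "j < 2" by simp_all
      then show "mat 2 2 (\<lambda>(i,j). (P *\<^sub>v [e,f] ! j) \<bullet>c [e,f] ! i) $$ (i,j) = (complex_of_real p \<cdot>\<^sub>m 1\<^sub>m 2) $$ (i,j)"
        using Pu[of j "[e,f] ! i"] ef by (auto simp: less_2_cases_iff)
    qed auto
    moreover have "\<exists>C \<in> carrier_mat m m. P = uconj W (bdiag 2 m (mat 2 2 (\<lambda>(i,j). (P *\<^sub>v [e,f] ! j) \<bullet>c [e,f] ! i)) C)"
    proof (rule blk[OF c(3) h(3)])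
      fix j v assume "j < (2::nat)" "v \<in> carrier_vec n" "\<And>i. i < 2 \<Longrightarrow> [e,f] ! i \<bullet>c v = 0"
      then show "(P *\<^sub>v [e,f] ! j) \<bullet>c v = 0" using Pu by simp
    qed
    ultimately obtain P2 where P2: "P2 \<in> carrier_mat m m"
      "P = uconj W (bdiag 2 m (complex_of_real p \<cdot>\<^sub>m 1\<^sub>m 2) P2)" by auto
    have c1: "a1 \<in> carrier_mat 2 2" "b1 \<in> carrier_mat 2 2" "complex_of_real p \<cdot>\<^sub>m 1\<^sub>m 2 \<in> carrier_mat 2 2"
      by (simp_all add: a1_def b1_def)
    have bc: "bdiag 2 m X Y \<in> carrier_mat n n" if "X \<in> carrier_mat 2 2" "Y \<in> carrier_mat m m" for X Y
      using four_block_carrier_mat[OF that] n by simp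
    have "strictly_compatible n (bdiag 2 m a1 a2) (bdiag 2 m b1 b2) (bdiag 2 m (complex_of_real p \<cdot>\<^sub>m 1\<^sub>m 2) P2)"
      using less.prems unfolding a2(2) b2(2) P2(2)
      by (subst (asm) strictly_compatible_uconj[OF W bc[OF c1(1) a2(1)] bc[OF c1(2) b2(1)] bc[OF c1(3) P2(1)]])
    then have H: "strictly_compatible 2 a1 b1 (complex_of_real p \<cdot>\<^sub>m 1\<^sub>m 2)" "strictly_compatible m a2 b2 P2"
      unfolding n[symmetric] using strictly_compatible_bdiag[OF c1 a2(1) b2(1) P2(1)] by blast+
    have "m < n" using n by simp
    from less.IH[OF this H(2)] obtain as bs V where ev: "even m" and
      len: "length as = m div 2" "length bs = m div 2" and S: "set as \<subseteq> S_set" "set bs \<subseteq> S_set" and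
      ac: "\<forall>i < m div 2. abs_compatible (as ! i) (bs ! i)" and
      dc: "diag_block_mat as \<in> carrier_mat m m" "diag_block_mat bs \<in> carrier_mat m m" and
      V: "V \<in> carrier_mat m m" "unitary_mat V" and
      eq: "a2 = uconj V (diag_block_mat as)" "b2 = uconj V (diag_block_mat bs)" by blast
    \<comment> \<open>The unitary found for the complement must leave the first block untouched,
      hence the identity of size 2 in front.\<close>
    define V' where "V' = bdiag 2 m (1\<^sub>m 2) V"
    have V': "V' \<in> carrier_mat n n" "unitary_mat V'"
      using V unitary_bdiag[of "1\<^sub>m 2" 2 V m] unitary_matI[of "1\<^sub>m 2" 2] bc by (auto simp: V'_def)
    have dbm: "diag_block_mat (X # Xs) = bdiag 2 m X (diag_block_mat Xs)"
      if "X \<in> carrier_mat 2 2" "diag_block_mat Xs \<in> carrier_mat m m" for X Xs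
      using that by (simp add: Let_def)
    have step: "uconj W (bdiag 2 m X (uconj V Y)) = uconj (W * V') (bdiag 2 m X Y)"
      if "X \<in> carrier_mat 2 2" "Y \<in> carrier_mat m m" for X Y
    proof -
      have "bdiag 2 m X (uconj V Y) = uconj V' (bdiag 2 m X Y)"
        unfolding V'_def using uconj_bdiag[OF _ V(1) that, of "1\<^sub>m 2"] that by (simp add: uconj_def)
      then show ?thesis using uconj_uconj[OF W(1) V'(1) bc[OF that]] by simp
    qed
    have "a = uconj (W * V') (diag_block_mat (a1 # as))" "b = uconj (W * V') (diag_block_mat (b1 # bs))"
      unfolding a2(2) b2(2) eq step[OF c1(1) dc(1)] step[OF c1(2) dc(2)] dbm[OF c1(1) dc(1)] dbm[OF c1(2) dc(2)]
      by (rule refl)+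
    moreover have "unitary_mat (W * V')" "W * V' \<in> carrier_mat n n"
      using unitary_mat_mult[OF W(2) V'(2) W(1) V'(1)] W V' by auto
    moreover have "diag_block_mat (a1 # as) \<in> carrier_mat n n" "diag_block_mat (b1 # bs) \<in> carrier_mat n n"
      unfolding dbm[OF c1(1) dc(1)] dbm[OF c1(2) dc(2)] using bc c1 dc by auto
    moreover have nm: "n div 2 = Suc (m div 2)" using n by auto
    moreover have "\<forall>i < n div 2. abs_compatible ((a1 # as) ! i) ((b1 # bs) ! i)"
      unfolding nm using ac strictly_compatible_2_2(3)[OF H(1)] by (auto simp: less_Suc_eq_0_disj)
    moreover have "set (a1 # as) \<subseteq> S_set" "set (b1 # bs) \<subseteq> S_set"
      using S strictly_compatible_2_2(1,2)[OF H(1)] by auto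
    moreover have "length (a1 # as) = n div 2" "length (b1 # bs) = n div 2" using len nm by auto
    moreover have "even n" using ev n by auto
    ultimately show ?thesis by blast
  qed
qed

theorem theorem3p9:
  fixes n :: nat and a b :: "complex mat"
  assumes "a \<in> carrier_mat n n" and "b \<in> carrier_mat n n"
    and "effect a" and "effect b"
    and "strict a" and "strict b"
    and "abs_compatible a b"
  shows "even n \<and>
    (\<exists>as bs w. length as = n div 2 \<and> length bs = n div 2 \<and>
       set as \<subseteq> S_set \<and> set bs \<subseteq> S_set \<and>
       (\<forall>i < n div 2. abs_compatible (as ! i) (bs ! i)) \<and>
       w \<in> carrier_mat n n \<and> unitary_mat w \<and>
       a = mat_adjoint w * diag_block_mat as * w \<and>
       b = mat_adjoint w * diag_block_mat bs * w)"
proof -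
  have h: "hermitian a" "hermitian b"
    using assms(3,4) by (auto simp: effect_def positive_mat_def)
  obtain P where "P \<in> carrier_mat n n" "positive_mat P" "positive_mat (1\<^sub>m n - P)"
    "P * P = (a - b) * (a - b)" "(1\<^sub>m n - P) * (1\<^sub>m n - P) = (1\<^sub>m n - a - b) * (1\<^sub>m n - a - b)"
    using assms(7) unfolding abs_compatible_iff[OF assms(1) h(1) assms(2) h(2)] by blast
  then have "strictly_compatible n a b P"
    using assms(1-4) strict_det[OF assms(1,5)] strict_det[OF assms(2,6)]
    unfolding strictly_compatible_def effect_def by simp
  from strictly_compatible_decomposition[OF this] obtain as bs W where
    "even n" "length as = n div 2" "length bs = n div 2" "set as \<subseteq> S_set" "set bs \<subseteq> S_set"
    "\<forall>i < n div 2. abs_compatible (as ! i) (bs ! i)" and W: "W \<in> carrier_mat n n" "unitary_mat W"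
    and eq: "a = uconj W (diag_block_mat as)" "b = uconj W (diag_block_mat bs)" by blast
  \<comment> \<open>The witness for \<open>w\<close> is the adjoint of \<open>W\<close>, which
    reconciles W(...)W* with the required form w*(...)w.\<close>
  moreover have "unitary_mat (mat_adjoint W)" "mat_adjoint W \<in> carrier_mat n n"
    using W unitary_mat_adjoint by auto
  moreover have "a = mat_adjoint (mat_adjoint W) * diag_block_mat as * mat_adjoint W"
    "b = mat_adjoint (mat_adjoint W) * diag_block_mat bs * mat_adjoint W"
    unfolding mat_adjoint_adjoint uconj_def[symmetric] by (fact eq)+
  ultimately show ?thesis by blast
qed

end
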